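(* For any integer $b \geq 1$, $X_{T^{\langle 4,b \rangle}_{v_4}}$ is not $e$-positive. In particular, for every integer $k \ge 0$, \begin{align*} [e_{(3^{k+2})}]X_{T^{\langle 4, 3k+1 \rangle}_{v_4}} &= -3\cdot 2^{k+1}, \\ [e_{(3^{k+2},1)}]X_{T^{\langle 4, 3k+2 \rangle}_{v_4}} &= - 2^{k+2}, \\ [e_{(3^{k+2},2)}]X_{T^{\langle 4, 3k+3 \rangle}_{v_4}} &= -(3k+1)\cdot 2^{k+1}. \end{align*}
   Context: For a finite simple graph $G$ with vertex set $\{v_1,\dots,v_d\}$, the chromatic symmetric function is $X_G=\sum_{\kappa} x_{\kappa(v_1)}\cdots x_{\kappa(v_d)}$, summed over all proper colorings $\kappa:V(G)\to\{1,2,\dots\}$, with commuting indeterminates. $e_\lambda=e_{\lambda_1}e_{\lambda_2}\cdots$ are the elementary symmetric functions, and $[e_\lambda]f$ denotes the coefficient of $e_\lambda$ in the expansion of a symmetric function $f$ in the $e$-basis; $G$ (or $X_G$) is $e$-positive if all these coefficients are non-negative. The partition $(3^{m},r)$ has $m$ parts equal to $3$ followed by a part $r$. For $a\ge3$, $b\ge1$, the tadpole graph $T^{\langle a,b\rangle}$ has vertices $v_1,\dots,v_{a+b}$ and consists of the cycle $v_1v_2\cdots v_av_1$, the path $v_{a+1}\cdots v_{a+b}$, and the edge $v_av_{a+1}$; so $v_4$ is the unique degree-$3$ vertex of $T^{\langle 4,b\rangle}$. For a graph $G$ and vertex $v$, the twin graph $G_v$ is obtained by adding a new vertex $v'$ adjacent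 to $v$ and to exactly the neighbors of $v$ in $G$. *)

theory Defs
  imports "HOL-Library.Multiset" "HOL-Library.FuncSet"
begin

section \<open>Formal power series in the indeterminates \<open>x\<^sub>0, x\<^sub>1, x\<^sub>2, \<dots>\<close>\<close>

text \<open>
  The multiset \<open>{#i\<^sub>1, \<dots>, i\<^sub>d#}\<close> stands for the monomial \<open>x\<^bsub>i\<^sub>1\<^esub> \<cdots> x\<^bsub>i\<^sub>d\<^esub>\<close>; arbitrary
  (infinite) families of coefficients are allowed. The indeterminates, and hence the
  colors below, are numbered from 0 instead of 1.
\<close>

typedef 'a mfps = "UNIV :: (nat multiset \<Rightarrow> 'a) set"
  morphisms mcoeff Abs_mfps
  by simp

lemma mcoeff_Abs_mfps [simp]: "mcoeff (Abs_mfps f) m = f m"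
  by (simp add: Abs_mfps_inverse)

lemma mfps_eqI: "(\<And>m. mcoeff f m = mcoeff g m) \<Longrightarrow> f = g"
  by (metis ext mcoeff_inject)

lemma finite_submultisets [simp]: "finite {a. a \<subseteq># (m :: 'b multiset)}"
proof (induction m)
  case empty
  then show ?case by simp
next
  case (add x m)
  have "{a. a \<subseteq># add_mset x m} \<subseteq> {a. a \<subseteq># m} \<union> add_mset x ` {a. a \<subseteq># m}"
  proof
    fix a assume "a \<in> {a. a \<subseteq># add_mset x m}"
    then have a: "a \<subseteq># add_mset x m" by simp
    show "a \<in> {a. a \<subseteq># m} \<union> add_mset x ` {a. a \<subseteq># m}"
    proof (cases "x \<in># a")
      case True
      then obtain a' where "a = add_mset x a'" by (meson multi_member_split)
      with a show ?thesis by simp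
    next
      case False
      have "count a y \<le> count m y" for y
        using a False by (cases "y = x") (auto simp: subseteq_mset_def not_in_iff dest: spec[of _ y])
      then show ?thesis by (simp add: subseteq_mset_def)
    qed
  qed
  with add.IH show ?case by (meson finite_UnI finite_imageI finite_subset)
qed

instantiation mfps :: (comm_ring_1) comm_ring_1
begin

definition "0 = Abs_mfps (\<lambda>_. 0)"

definition "1 = Abs_mfps (\<lambda>m. if m = {#} then 1 else 0)"

definition "f + g = Abs_mfps (\<lambda>m. mcoeff f m + mcoeff g m)"

definition "- f = Abs_mfps (\<lambda>m. - mcoeff f m)"

definition "f - g = Abs_mfps (\<lambda>m. mcoeff f m - mcoeff g m)"

definition "f * g = Abs_mfps (\<lambda>m. \<Sum>a | a \<subseteq># m. mcoeff f a * mcoeff g (m - a))"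

instance
proof
  fix f g h :: "'a mfps"
  show "f * g = g * f"
  proof (rule mfps_eqI)
    fix m :: "nat multiset"
    have diff: "m - (m - a) = a" if "a \<subseteq># m" for a
      using that by (auto simp: multiset_eq_iff subseteq_mset_def)
    have "(\<Sum>a | a \<subseteq># m. mcoeff f a * mcoeff g (m - a)) =
          (\<Sum>a | a \<subseteq># m. mcoeff g a * mcoeff f (m - a))"
      by (rule sum.reindex_bij_witness[of _ "\<lambda>a. m - a" "\<lambda>a. m - a"])
         (auto simp: mult.commute diff)
    then show "mcoeff (f * g) m = mcoeff (g * f) m"
      by (simp add: times_mfps_def)
  qed
  show "f * g * h = f * (g * h)"
  proof (rule mfps_eqI)
    fix m :: "nat multiset"
    have F1: "a + (c - a) = c" "c - a \<subseteq># m - a" "m - a - (c - a) = m - c"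
      if "a \<subseteq># c" "c \<subseteq># m" for a c
      using that by (auto simp: multiset_eq_iff subseteq_mset_def diff_le_mono)
    have F2: "a + b \<subseteq># m" if "a \<subseteq># m" "b \<subseteq># m - a" for a b
      using that by (simp add: subseteq_mset_def) (metis add.commute le_diff_conv2)
    have "(\<Sum>c | c \<subseteq># m. \<Sum>a | a \<subseteq># c. mcoeff f a * mcoeff g (c - a) * mcoeff h (m - c)) =
          (\<Sum>a | a \<subseteq># m. \<Sum>b | b \<subseteq># m - a. mcoeff f a * mcoeff g b * mcoeff h (m - a - b))"
      unfolding sum.Sigma[OF finite_submultisets ballI[OF finite_submultisets]]
      by (rule sum.reindex_bij_witness[of _ "\<lambda>(a, b). (a + b, a)" "\<lambda>(c, a). (a, c - a)"])
         (auto simp: F1 F2 intro: subset_mset.order_trans)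
    then show "mcoeff (f * g * h) m = mcoeff (f * (g * h)) m"
      by (simp add: times_mfps_def sum_distrib_left sum_distrib_right mult.assoc)
  qed
  show "1 * f = f"
  proof (rule mfps_eqI)
    fix m :: "nat multiset"
    have "(\<Sum>a | a \<subseteq># m. (if a = {#} then 1 else 0) * mcoeff f (m - a)) =
          (\<Sum>a | a \<subseteq># m. if a = {#} then mcoeff f m else 0)"
      by (rule sum.cong) auto
    then show "mcoeff (1 * f) m = mcoeff f m"
      by (simp add: times_mfps_def one_mfps_def)
  qed
  show "(f + g) * h = f * h + g * h"
    by (rule mfps_eqI) (simp add: times_mfps_def plus_mfps_def distrib_right sum.distrib)
  show "(0 :: 'a mfps) \<noteq> 1"
  proof
    assume "(0 :: 'a mfps) = 1"
    then have "mcoeff (0 :: 'a mfps) {#} = mcoeff 1 {#}" by simp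
    then show False by (simp add: zero_mfps_def one_mfps_def)
  qed
qed (rule mfps_eqI; simp add: plus_mfps_def zero_mfps_def uminus_mfps_def minus_mfps_def
      algebra_simps)+

end


section \<open>Expansions in elementary symmetric functions\<close>

definition elem_sym :: "nat \<Rightarrow> int mfps" where
  "elem_sym n = Abs_mfps (\<lambda>m. if size m = n \<and> (\<forall>i. count m i \<le> 1) then 1 else 0)"

text \<open>An integer partition is the multiset of its (positive) parts.\<close>

definition is_partition :: "nat multiset \<Rightarrow> bool" where
  "is_partition lam \<longleftrightarrow> 0 \<notin># lam"

definition elem_sym_part :: "nat multiset \<Rightarrow> int mfps" where
  "elem_sym_part lam = (\<Prod>i\<in>#lam. elem_sym i)"

definition is_e_expansion :: "int mfps \<Rightarrow> (nat multiset \<Rightarrow> int) \<Rightarrow> bool" where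
  "is_e_expansion f c \<longleftrightarrow>
     finite {lam. c lam \<noteq> 0} \<and> (\<forall>lam. c lam \<noteq> 0 \<longrightarrow> is_partition lam) \<and>
     f = (\<Sum>lam | c lam \<noteq> 0. of_int (c lam) * elem_sym_part lam)"

text \<open>Unspecified if \<open>f\<close> is not a symmetric function of bounded degree.\<close>

definition e_coeff :: "nat multiset \<Rightarrow> int mfps \<Rightarrow> int" where
  "e_coeff lam f = (THE c. is_e_expansion f c) lam"

definition e_positive :: "int mfps \<Rightarrow> bool" where
  "e_positive f \<longleftrightarrow> (\<forall>lam. is_partition lam \<longrightarrow> e_coeff lam f \<ge> 0)"


section \<open>Graphs and chromatic symmetric functions\<close>

type_synonym 'a graph = "'a set \<times> 'a set set"

definition verts :: "'a graph \<Rightarrow> 'a set" where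
  "verts G = fst G"

definition edges :: "'a graph \<Rightarrow> 'a set set" where
  "edges G = snd G"

definition fin_simple_graph :: "'a graph \<Rightarrow> bool" where
  "fin_simple_graph G \<longleftrightarrow>
     finite (verts G) \<and> (\<forall>e\<in>edges G. \<exists>u\<in>verts G. \<exists>v\<in>verts G. u \<noteq> v \<and> e = {u, v})"

definition proper_colorings :: "'a graph \<Rightarrow> ('a \<Rightarrow> nat) set" where
  "proper_colorings G =
     {\<kappa> \<in> verts G \<rightarrow>\<^sub>E UNIV. \<forall>u v. {u, v} \<in> edges G \<longrightarrow> \<kappa> u \<noteq> \<kappa> v}"

text \<open>
  The coefficient of a monomial \<open>m\<close> counts the proper colorings \<open>\<kappa>\<close> whose monomial
  \<open>\<Prod>v. x\<^bsub>\<kappa> v\<^esub>\<close> is \<open>m\<close>.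
\<close>

definition chromatic_sym :: "'a graph \<Rightarrow> int mfps" where
  "chromatic_sym G =
     Abs_mfps (\<lambda>m. int (card {\<kappa> \<in> proper_colorings G. image_mset \<kappa> (mset_set (verts G)) = m}))"

definition tadpole :: "nat \<Rightarrow> nat \<Rightarrow> nat graph" where
  "tadpole a b =
     ({1..a + b},
      {{i, i + 1} | i. 1 \<le> i \<and> i < a} \<union> {{a, 1}} \<union>
      {{i, i + 1} | i. a + 1 \<le> i \<and> i < a + b} \<union> {{a, a + 1}})"

text \<open>The new vertex \<open>v'\<close> is \<open>None\<close>.\<close>

definition twin :: "'a graph \<Rightarrow> 'a \<Rightarrow> 'a option graph" where
  "twin G v =
     (insert None (Some ` verts G),
      (`) Some ` edges G \<union> {{None, Some v}} \<union> {{None, Some u} | u. {v, u} \<in> edges G})"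

lemma fin_simple_graph_tadpole:
  assumes "a \<ge> 3" and "b \<ge> 1"
  shows "fin_simple_graph (tadpole a b)"
  unfolding fin_simple_graph_def verts_def edges_def tadpole_def fst_conv snd_conv
proof (intro conjI ballI)
  fix e
  assume "e \<in> {{i, i + 1} | i. 1 \<le> i \<and> i < a} \<union> {{a, 1}} \<union>
      {{i, i + 1} | i. a + 1 \<le> i \<and> i < a + b} \<union> {{a, a + 1}}"
  then consider i where "e = {i, i + 1}" "1 \<le> i" "i < a + b" | "e = {a, 1}"
    using assms by fastforce
  then show "\<exists>u\<in>{1..a + b}. \<exists>v\<in>{1..a + b}. u \<noteq> v \<and> e = {u, v}"
  proof cases
    case (1 i)
    then show ?thesis by (intro bexI[of _ i] bexI[of _ "i + 1"]) auto
  next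
    case 2
    then show ?thesis using assms by (intro bexI[of _ a] bexI[of _ 1]) auto
  qed
qed simp

lemma fin_simple_graph_twin:
  assumes "fin_simple_graph G" and "v \<in> verts G"
  shows "fin_simple_graph (twin G v)"
  unfolding fin_simple_graph_def
proof (intro conjI ballI)
  show "finite (verts (twin G v))"
    using assms(1) by (simp add: fin_simple_graph_def twin_def verts_def)
next
  fix e assume "e \<in> edges (twin G v)"
  then consider e' where "e' \<in> edges G" "e = Some ` e'" | "e = {None, Some v}"
    | u where "{v, u} \<in> edges G" "e = {None, Some u}"
    by (auto simp: twin_def edges_def)
  then show "\<exists>x\<in>verts (twin G v). \<exists>y\<in>verts (twin G v). x \<noteq> y \<and> e = {x, y}"
  proof cases
    case (1 e')
    then obtain x y where "x \<in> verts G" "y \<in> verts G" "x \<noteq> y" "e' = {x, y}"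
      using assms(1) by (auto simp: fin_simple_graph_def)
    then show ?thesis using 1
      by (intro bexI[of _ "Some x"] bexI[of _ "Some y"]) (auto simp: twin_def verts_def)
  next
    case 2
    then show ?thesis using assms(2)
      by (intro bexI[of _ None] bexI[of _ "Some v"]) (auto simp: twin_def verts_def)
  next
    case (3 u)
    then have "u \<in> verts G"
      using assms(1) unfolding fin_simple_graph_def by (metis doubleton_eq_iff)
    then show ?thesis using 3
      by (intro bexI[of _ None] bexI[of _ "Some u"]) (auto simp: twin_def verts_def)
  qed
qed

end

theory Submission
  imports Defs "HOL-Library.Multiset_Order" "HOL-Library.Poly_Mapping"
    "HOL-Computational_Algebra.Formal_Power_Series"
begin

text \<open>
  Restrict to finitely many colors. Let \<open>P\<^sub>n\<close> be the chromatic symmetric function of the path on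
  \<open>n\<close> vertices and \<open>F\<^sub>n(a)\<close> the part of it in which the first vertex has color \<open>a\<close>, so that
  \<open>F\<^bsub>n+1\<^esub>(a) = x\<^sub>a (P\<^sub>n - F\<^sub>n(a))\<close>. If \<open>v\<^sub>4\<close> and its twin get the colors \<open>p \<noteq> q\<close>, the tail contributes
  \<open>P\<^sub>b - F\<^sub>b(p) - F\<^sub>b(q)\<close>, while \<open>v\<^sub>1, v\<^sub>2, v\<^sub>3\<close> contribute a polynomial in \<open>x\<^sub>p\<close>, \<open>x\<^sub>q\<close> and the power sums.
  Summing over \<open>p, q\<close> and eliminating \<open>\<Sum>\<^sub>a x\<^sub>a\<^sup>j F\<^sub>b(a)\<close> by the recursion expresses the chromatic
  symmetric function as a combination of \<open>P\<^sub>b, \<dots>, P\<^bsub>b+5\<^esub>\<close> whose coefficients become polynomials in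
  \<open>e\<^sub>1, \<dots>, e\<^sub>5\<close> by Newton's identities. The same recursion gives \<open>E(z) P(z) = E(z) + z E'(z) P(z)\<close>,
  that is, \<open>P\<^sub>n = e\<^sub>n + \<Sum>\<^sub>i (i - 1) e\<^sub>i P\<^bsub>n-i\<^esub>\<close>, from which the coefficients at \<open>(3\<^sup>m, r)\<close> are read off.
\<close>

lemma mcoeff_zero [simp]: "mcoeff 0 m = 0"
  and mcoeff_add [simp]: "mcoeff (f + g) m = mcoeff f m + mcoeff g m"
  and mcoeff_uminus [simp]: "mcoeff (- f) m = - mcoeff f m"
  by (simp_all add: zero_mfps_def plus_mfps_def uminus_mfps_def)

lemma mcoeff_sum: "mcoeff (sum f I) m = (\<Sum>i\<in>I. mcoeff (f i) m)"
  by (induction I rule: infinite_finite_induct) simp_all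

lemma mcoeff_of_int_mult: "mcoeff (of_int c * f) m = of_int c * mcoeff f m"
proof -
  have nat: "mcoeff (of_nat n * f) m = of_nat n * mcoeff f m" for n
    by (induction n) (simp_all add: distrib_right)
  show ?thesis
    by (cases c rule: int_cases2) (simp_all add: nat)
qed

section \<open>Algebraic independence of the elementary symmetric functions\<close>

text \<open>
  In the multiset order (induced by the order of the color indices) the least monomial of
  \<open>e\<^sub>i\<close> is \<open>x\<^sub>0 \<cdots> x\<^bsub>i-1\<^esub>\<close>, and least monomials multiply. The least monomials of distinct
  \<open>e\<^sub>\<lambda>\<close> are distinct because they are the conjugate partitions.
\<close>

definition least_monomial :: "nat multiset \<Rightarrow> nat multiset" where
  "least_monomial lam = (\<Sum>i\<in>#lam. mset_set {..<i})"

lemma least_monomial_empty [simp]: "least_monomial {#} = {#}"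
  and least_monomial_add [simp]:
    "least_monomial (add_mset i lam) = mset_set {..<i} + least_monomial lam"
  by (simp_all add: least_monomial_def)

text \<open>Among n+1 distinct indices some x is at least n. Comparing x with n and the remaining
  indices with 0, ..., n-1 suffices, because the multiset order is compatible with addition.\<close>

lemma mset_set_lessThan_le_squarefree:
  fixes m :: "nat multiset"
  assumes "size m = n" "\<And>i. count m i \<le> 1"
  shows "mset_set {..<n} \<le> m"
  using assms
proof (induction n arbitrary: m)
  case 0
  then show ?case by simp
next
  case (Suc n)
  have m: "m = mset_set (set_mset m)"
    by (metis Suc.prems(2) count_eq_zero_iff count_mset_set(1,3) finite_set_mset le_antisym
        less_one multiset_eqI not_less)
  have "card (set_mset m) = Suc n"
    by (metis Suc.prems(1) m size_mset_set)
  have "\<exists>x\<in>#m. n \<le> x"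
  proof (rule ccontr)
    assume "\<not> (\<exists>x\<in>#m. n \<le> x)"
    then have "set_mset m \<subseteq> {..<n}" by (auto simp: not_le)
    then have "card (set_mset m) \<le> n"
      by (metis card_lessThan card_mono finite_lessThan)
    with \<open>card (set_mset m) = Suc n\<close> show False by simp
  qed
  then obtain x where x: "x \<in># m" "n \<le> x" by blast
  then obtain m' where m': "m = add_mset x m'" by (meson multi_member_split)
  have "count m' i \<le> 1" for i
    using Suc.prems(2)[of i] by (auto simp: m' split: if_splits)
  with Suc.prems(1) have IH: "mset_set {..<n} \<le> m'"
    by (intro Suc.IH) (auto simp: m')
  have "{#n#} \<le> {#x#}"
    using x(2) by (cases "n = x") (auto intro: less_imp_le)
  with IH have "mset_set {..<n} + {#n#} \<le> m' + {#x#}"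
    by (rule add_mono)
  then show ?case by (simp add: m' lessThan_Suc)
qed

text \<open>A monomial of a product splits into monomials of the factors, and the lower bounds for
  these add up.\<close>

lemma mcoeff_elem_sym_part_nonzero:
  "mcoeff (elem_sym_part lam) m \<noteq> 0 \<Longrightarrow> least_monomial lam \<le> m"
proof (induction lam arbitrary: m)
  case empty
  then show ?case by simp
next
  case (add i lam)
  from add.prems obtain a where a: "a \<subseteq># m" "mcoeff (elem_sym i) a \<noteq> 0"
      "mcoeff (elem_sym_part lam) (m - a) \<noteq> 0"
    by (auto simp: elem_sym_part_def times_mfps_def elim!: sum.not_neutral_contains_not_neutral)
  from a(2) have "mset_set {..<i} \<le> a"
    by (intro mset_set_lessThan_le_squarefree) (auto simp: elem_sym_def split: if_splits)
  then have "mset_set {..<i} + least_monomial lam \<le> a + (m - a)"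
    using add.IH[OF a(3)] by (rule add_mono)
  with a(1) show ?case by simp
qed

lemma mcoeff_elem_sym_part_least_monomial:
  "mcoeff (elem_sym_part lam) (least_monomial lam) = 1"
proof (induction lam)
  case empty
  then show ?case by (simp add: elem_sym_part_def one_mfps_def)
next
  case (add i lam)
  let ?u = "mset_set {..<i}" and ?v = "least_monomial lam"
  \<comment> \<open>Any other contributing splitting has a first factor strictly above
    \<open>?u\<close> and a second at least \<open>?v\<close>, so its sum would exceed
    \<open>?u + ?v\<close>.\<close>
  have zero: "mcoeff (elem_sym i) a * mcoeff (elem_sym_part lam) (?u + ?v - a) = 0"
    if "a \<subseteq># ?u + ?v" "a \<noteq> ?u" for a
  proof (rule ccontr)
    assume nz: "\<not> ?thesis"
    then have "?u \<le> a"
      by (intro mset_set_lessThan_le_squarefree) (auto simp: elem_sym_def split: if_splits)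
    with that(2) have "?u < a" by simp
    moreover have "?v \<le> ?u + ?v - a"
      using nz by (intro mcoeff_elem_sym_part_nonzero) auto
    ultimately have "?u + ?v < a + (?u + ?v - a)"
      by (rule add_less_le_mono)
    with that(1) show False by simp
  qed
  have "mcoeff (elem_sym_part (add_mset i lam)) (least_monomial (add_mset i lam)) =
        (\<Sum>a | a \<subseteq># ?u + ?v. mcoeff (elem_sym i) a * mcoeff (elem_sym_part lam) (?u + ?v - a))"
    by (simp add: elem_sym_part_def times_mfps_def)
  also have "\<dots> = (\<Sum>a\<in>{?u}. mcoeff (elem_sym i) a * mcoeff (elem_sym_part lam) (?u + ?v - a))"
    by (rule sum.mono_neutral_right) (use zero in auto)
  also have "\<dots> = 1"
    using add.IH by (simp add: elem_sym_def count_mset_set')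
  finally show ?case .
qed

text \<open>The exponents of the least monomial are the parts of the conjugate partition.\<close>

lemma count_least_monomial: "count (least_monomial lam) j = size (filter_mset (\<lambda>i. j < i) lam)"
  by (induction lam) (auto simp: count_mset_set')

text \<open>The multiplicity of the part j+1 is the difference of the exponents at j and j+1. Parts
  equal to 0 leave no trace in the monomial, so they have to be excluded.\<close>

lemma least_monomial_inject:
  assumes "is_partition lam" "is_partition mu" "least_monomial lam = least_monomial mu"
  shows "lam = mu"
proof (rule multiset_eqI)
  fix i
  have *: "size (filter_mset (\<lambda>k. j < k) nu) = count nu (Suc j) + size (filter_mset (\<lambda>k. Suc j < k) nu)"
    for j :: nat and nu
    by (induction nu) auto
  show "count lam i = count mu i"
  proof (cases i)
    case 0
    then show ?thesis using assms(1,2) by (simp add: is_partition_def not_in_iff)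
  next
    case (Suc j)
    show ?thesis
      using arg_cong[OF assms(3), of "\<lambda>m. count m j"] arg_cong[OF assms(3), of "\<lambda>m. count m i"]
        *[of j lam] *[of j mu]
      by (simp add: count_least_monomial Suc)
  qed
qed

section \<open>Polynomials in the elementary symmetric functions\<close>

text \<open>Instantiated by \<open>epoly_eval\<close> and by \<open>truncate N\<close>, so that
  \<open>path_e\<close> and \<open>twin_tadpole_e\<close> can be carried along both maps.\<close>

locale ring_1_hom =
  fixes h :: "'a::comm_ring_1 \<Rightarrow> 'b::comm_ring_1"
  assumes hom_one: "h 1 = 1"
    and hom_add: "h (x + y) = h x + h y"
    and hom_mult: "h (x * y) = h x * h y"
begin

lemma hom_zero: "h 0 = 0"
  using hom_add[of 0 0] by simp

lemma hom_uminus: "h (- x) = - h x"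
  using hom_add[of x "- x"] hom_zero by (simp add: eq_neg_iff_add_eq_0 add.commute)

lemma hom_diff: "h (x - y) = h x - h y"
  using hom_add[of x "- y"] by (simp add: hom_uminus)

lemma hom_of_nat: "h (of_nat n) = of_nat n"
  by (induction n) (simp_all add: hom_zero hom_one hom_add)

lemma hom_numeral: "h (numeral n) = numeral n"
  using hom_of_nat[of "numeral n"] by simp

lemma hom_sum: "h (sum f I) = (\<Sum>i\<in>I. h (f i))"
  by (induction I rule: infinite_finite_induct) (simp_all add: hom_zero hom_add)

end

text \<open>Integer polynomials in formal variables for the elementary symmetric functions: a
  multiset of indices is a monomial, and multiplying monomials adds multisets.\<close>

type_synonym epoly = "nat multiset \<Rightarrow>\<^sub>0 int"

definition epoly_eval :: "epoly \<Rightarrow> int mfps" where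
  "epoly_eval p = (\<Sum>lam\<in>Poly_Mapping.keys p. of_int (Poly_Mapping.lookup p lam) * elem_sym_part lam)"

definition epoly_var :: "nat \<Rightarrow> epoly" where
  "epoly_var i = Poly_Mapping.single {#i#} 1"

lemma epoly_eval_zero: "epoly_eval 0 = 0"
  by (simp add: epoly_eval_def)

lemma epoly_eval_add: "epoly_eval (p + q) = epoly_eval p + epoly_eval q"
  unfolding epoly_eval_def
  by (rule setsum_keys_plus_distrib) (simp_all add: distrib_right)

lemma epoly_eval_diff: "epoly_eval (p - q) = epoly_eval p - epoly_eval q"
  using epoly_eval_add[of "p - q" q] by simp

lemma epoly_eval_single: "epoly_eval (Poly_Mapping.single lam 1) = elem_sym_part lam"
  by (simp add: epoly_eval_def)

text \<open>As an additive group \<open>epoly\<close> is free abelian on the monomials, so additive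
  statements need checking only on monomials and differences.\<close>

lemmas epoly_induct [case_names zero one diff] = frag_induction[OF subset_UNIV]

lemma epoly_eval_mult: "epoly_eval (p * q) = epoly_eval p * epoly_eval q"
proof (induction p rule: epoly_induct)
  case (one lam)
  show ?case
    by (induction q rule: epoly_induct)
      (simp_all add: epoly_eval_zero epoly_eval_diff right_diff_distrib mult_single
        epoly_eval_single elem_sym_part_def)
qed (simp_all add: epoly_eval_zero epoly_eval_diff left_diff_distrib)

interpretation epoly_eval: ring_1_hom epoly_eval
  by unfold_locales
    (simp_all add: epoly_eval_add epoly_eval_mult single_one[symmetric] epoly_eval_single
      elem_sym_part_def del: single_one)

lemma epoly_eval_var: "epoly_eval (epoly_var i) = elem_sym i"
  by (simp add: epoly_var_def epoly_eval_single elem_sym_part_def)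

text \<open>Excludes the variable with index 0: it evaluates to \<open>elem_sym 0\<close>, which is
  1, so evaluation is not injective on all of \<open>epoly\<close>.\<close>

definition partition_keys :: "epoly \<Rightarrow> bool" where
  "partition_keys p \<longleftrightarrow> (\<forall>lam\<in>Poly_Mapping.keys p. is_partition lam)"

lemma epoly_eval_eq_0_imp:
  assumes "partition_keys p" "epoly_eval p = 0"
  shows "p = 0"
proof (rule ccontr)
  let ?K = "Poly_Mapping.keys p"
  assume "p \<noteq> 0"
  then have "?K \<noteq> {}" by simp
  \<comment> \<open>At the smallest of the least monomials only one key contributes, since distinct
    partitions have distinct least monomials.\<close>
  then obtain lam where lam: "lam \<in> ?K"
    and least: "\<And>mu. mu \<in> ?K \<Longrightarrow> least_monomial lam \<le> least_monomial mu"
    using ex_min_if_finite[of "least_monomial ` ?K"] by (auto simp: not_less)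
  have zero: "mcoeff (elem_sym_part mu) (least_monomial lam) = 0" if "mu \<in> ?K" "mu \<noteq> lam" for mu
  proof (rule ccontr)
    assume "\<not> ?thesis"
    then have "least_monomial mu = least_monomial lam"
      using least[OF that(1)] mcoeff_elem_sym_part_nonzero[of mu] by (metis antisym)
    then show False
      using that lam assms(1) least_monomial_inject[of mu lam] by (simp add: partition_keys_def)
  qed
  have "mcoeff (epoly_eval p) (least_monomial lam) =
      (\<Sum>mu\<in>?K. Poly_Mapping.lookup p mu * mcoeff (elem_sym_part mu) (least_monomial lam))"
    by (simp add: epoly_eval_def mcoeff_sum mcoeff_of_int_mult)
  also have "\<dots> = (\<Sum>mu\<in>{lam}. Poly_Mapping.lookup p mu * mcoeff (elem_sym_part mu) (least_monomial lam))"
    by (rule sum.mono_neutral_right) (use lam zero in auto)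
  also have "\<dots> \<noteq> 0"
    using lam by (simp add: mcoeff_elem_sym_part_least_monomial in_keys_iff)
  finally show False using assms(2) by simp
qed

lemma partition_keys_one: "partition_keys 1"
  and partition_keys_var: "0 < i \<Longrightarrow> partition_keys (epoly_var i)"
  by (simp_all add: partition_keys_def epoly_var_def is_partition_def)

lemma partition_keys_add: "partition_keys p \<Longrightarrow> partition_keys q \<Longrightarrow> partition_keys (p + q)"
  using keys_add[of p q] by (auto simp: partition_keys_def)

lemma partition_keys_diff: "partition_keys p \<Longrightarrow> partition_keys q \<Longrightarrow> partition_keys (p - q)"
  using keys_diff[of p q] by (auto simp: partition_keys_def)

lemma partition_keys_mult: "partition_keys p \<Longrightarrow> partition_keys q \<Longrightarrow> partition_keys (p * q)"
  using keys_mult[of p q] by (fastforce simp: partition_keys_def is_partition_def)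

lemma partition_keys_of_nat: "partition_keys (of_nat n)"
  by (induction n) (simp_all add: partition_keys_add partition_keys_one, simp add: partition_keys_def)

lemma partition_keys_numeral: "partition_keys (numeral n)"
  using partition_keys_of_nat[of "numeral n"] by simp

lemma partition_keys_sum: "(\<And>i. i \<in> I \<Longrightarrow> partition_keys (f i)) \<Longrightarrow> partition_keys (sum f I)"
  using keys_sum[of f I] by (fastforce simp: partition_keys_def)

text \<open>Justifies the definite description in \<open>e_coeff\<close>: two expansions of the same
  series give polynomials whose difference evaluates to 0.\<close>

lemma e_coeff_epoly_eval:
  assumes "partition_keys p"
  shows "e_coeff lam (epoly_eval p) = Poly_Mapping.lookup p lam"
proof -
  have "(THE c. is_e_expansion (epoly_eval p) c) = Poly_Mapping.lookup p"
  proof (rule the_equality)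
    have "{lam. Poly_Mapping.lookup p lam \<noteq> 0} = Poly_Mapping.keys p"
      by (auto simp: in_keys_iff)
    then show "is_e_expansion (epoly_eval p) (Poly_Mapping.lookup p)"
      using assms by (auto simp: is_e_expansion_def epoly_eval_def partition_keys_def in_keys_iff)
  next
    fix c assume c: "is_e_expansion (epoly_eval p) c"
    define q where "q = Abs_poly_mapping c"
    have q: "Poly_Mapping.lookup q = c"
      using c by (simp add: q_def is_e_expansion_def lookup_Abs_poly_mapping)
    have keys: "Poly_Mapping.keys q = {lam. c lam \<noteq> 0}"
      by (auto simp: in_keys_iff q)
    have "epoly_eval q = epoly_eval p"
      using c by (simp add: epoly_eval_def[of q] is_e_expansion_def keys q)
    moreover have "partition_keys q"
      using c by (simp add: partition_keys_def keys is_e_expansion_def)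
    ultimately have "p - q = 0"
      using assms by (intro epoly_eval_eq_0_imp partition_keys_diff) (auto simp: epoly_eval_diff)
    then show "c = Poly_Mapping.lookup p" using q by simp
  qed
  then show ?thesis by (simp add: e_coeff_def)
qed

section \<open>Paths in finitely many variables\<close>

text \<open>
  The argument \<open>e\<close> takes three interpretations, related by ring homomorphisms: formal variables,
  elementary symmetric functions, and elementary symmetric polynomials in finitely many variables.
\<close>

fun path_e :: "(nat \<Rightarrow> 'a::comm_ring_1) \<Rightarrow> nat \<Rightarrow> 'a" where
  "path_e e 0 = 1"
| "path_e e (Suc n) = e (Suc n) + (\<Sum>i=1..n. of_nat i * (e (Suc i) * path_e e (n - i)))"

text \<open>The outcome of the elimination carried out in \<open>twin_tadpole_sum_eq\<close>. With
  \<open>e i\<close> in degree i it is homogeneous of degree b+5, the number of vertices of the twin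
  graph.\<close>

definition twin_tadpole_e :: "(nat \<Rightarrow> 'a::comm_ring_1) \<Rightarrow> nat \<Rightarrow> 'a" where
  "twin_tadpole_e e b =
     20 * path_e e (b + 5) + 2 * (e 1 * path_e e (b + 4)) - 16 * (e 2 * path_e e (b + 3))
     - 2 * (e 1 * (e 2 * path_e e (b + 2))) - 42 * (e 3 * path_e e (b + 2))
     - 4 * (e 1 * (e 3 * path_e e (b + 1))) - 4 * (e 2 * (e 2 * path_e e (b + 1)))
     - 56 * (e 4 * path_e e (b + 1)) - 6 * (e 1 * (e 4 * path_e e b))
     - 4 * (e 2 * (e 3 * path_e e b)) - 50 * (e 5 * path_e e b)"

context ring_1_hom
begin

lemma hom_path_e: "h (path_e e n) = path_e (\<lambda>i. h (e i)) n"
  by (induction n rule: less_induct, rename_tac n, case_tac n)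
    (simp_all add: hom_one hom_add hom_mult hom_sum hom_of_nat)

lemma hom_twin_tadpole_e: "h (twin_tadpole_e e b) = twin_tadpole_e (\<lambda>i. h (e i)) b"
  by (simp only: twin_tadpole_e_def hom_path_e hom_add hom_diff hom_mult hom_numeral)

end

text \<open>Proper colorings of a path on \<open>n\<close> vertices whose first color is not in \<open>S\<close>.\<close>

fun path_sum :: "nat set \<Rightarrow> (nat \<Rightarrow> 'a::comm_ring_1) \<Rightarrow> nat \<Rightarrow> nat set \<Rightarrow> 'a" where
  "path_sum A x 0 S = 1"
| "path_sum A x (Suc n) S = (\<Sum>a\<in>A - S. x a * path_sum A x n {a})"

section \<open>Generating functions of elementary symmetric polynomials and of paths\<close>

definition efps :: "nat set \<Rightarrow> (nat \<Rightarrow> 'a::comm_ring_1) \<Rightarrow> 'a fps" where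
  "efps A x = (\<Prod>i\<in>A. 1 + fps_const (x i) * fps_X)"

text \<open>The elementary symmetric polynomials, taken as coefficients of E(z) so that their
  recursions become identities of power series.\<close>

definition esum :: "nat set \<Rightarrow> (nat \<Rightarrow> 'a::comm_ring_1) \<Rightarrow> nat \<Rightarrow> 'a" where
  "esum A x k = fps_nth (efps A x) k"

lemma esum_0: "finite A \<Longrightarrow> esum A x 0 = 1"
  unfolding esum_def efps_def by (induction A rule: finite_induct) (simp_all)

lemma efps_remove:
  "finite A \<Longrightarrow> a \<in> A \<Longrightarrow> efps A x = (1 + fps_const (x a) * fps_X) * efps (A - {a}) x"
  unfolding efps_def by (rule prod.remove)

lemma fps_deriv_efps:
  "finite A \<Longrightarrow> fps_deriv (efps A x) = (\<Sum>a\<in>A. fps_const (x a) * efps (A - {a}) x)"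
proof (induction A rule: finite_induct)
  case empty
  then show ?case by (simp add: efps_def)
next
  case (insert b A)
  have "(\<Sum>a\<in>A. fps_const (x a) * efps (insert b A - {a}) x) =
      (\<Sum>a\<in>A. fps_const (x a) * ((1 + fps_const (x b) * fps_X) * efps (A - {a}) x))"
  proof (rule sum.cong)
    fix a assume "a \<in> A"
    then have "insert b A - {a} = insert b (A - {a})" using insert by auto
    then show "fps_const (x a) * efps (insert b A - {a}) x =
        fps_const (x a) * ((1 + fps_const (x b) * fps_X) * efps (A - {a}) x)"
      using insert by (simp add: efps_def)
  qed simp
  also have "\<dots> = (1 + fps_const (x b) * fps_X) * fps_deriv (efps A x)"
    unfolding insert.IH by (simp add: sum_distrib_left mult_ac)
  finally have 1: "(\<Sum>a\<in>A. fps_const (x a) * efps (insert b A - {a}) x) = \<dots>" .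
  have 2: "efps (insert b A) x = (1 + fps_const (x b) * fps_X) * efps A x"
    using insert by (simp add: efps_def)
  show ?case
    using insert by (simp add: 1 2 algebra_simps)
qed

text \<open>The left side is F_{n+1}(a), the part in which the first color is a. On the right,
  \<open>path_sum A x n {a}\<close> is P_n - F_n(a).\<close>

lemma path_sum_diff:
  assumes "finite A" "a \<in> A"
  shows "path_sum A x (Suc n) {} - path_sum A x (Suc n) {a} = x a * path_sum A x n {a}"
  using assms by (simp add: sum.remove[of A a])

text \<open>A first color cannot be both a and b, so the two excluded parts are subtracted
  separately. This decouples the colors of the two twins in the tail.\<close>

lemma path_sum_pair:
  assumes "finite A" "a \<in> A" "b \<in> A" "a \<noteq> b" "0 < n"
  shows "path_sum A x n {a, b} =
    path_sum A x n {} - (path_sum A x n {} - path_sum A x n {a})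
      - (path_sum A x n {} - path_sum A x n {b})"
proof -
  obtain k where n: "n = Suc k" using assms(5) by (cases n) auto
  have "path_sum A x n {} = x a * path_sum A x k {a} + (x b * path_sum A x k {b} + path_sum A x n {a, b})"
    using assms by (simp add: n sum.remove[of A a] sum.remove[of "A - {a}" b] Diff_insert2[symmetric] insert_commute)
  then show ?thesis
    unfolding n path_sum_diff[OF assms(1,2)] path_sum_diff[OF assms(1,3)] by (simp add: algebra_simps)
qed

text \<open>Summing the recursion over n gives (1 + x_a z) F_a = x_a z P, and P = 1 + sum of the
  F_a, where 1 counts the empty path. Multiplying by E turns the sum into z E' P; splitting the
  factor 1 + x_a z off E avoids any division.\<close>

lemma path_fps_eq:
  fixes x :: "nat \<Rightarrow> 'a::comm_ring_1"
  assumes "finite A"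
  defines "P \<equiv> Abs_fps (\<lambda>n. path_sum A x n {})"
  shows "efps A x * P = efps A x + fps_X * fps_deriv (efps A x) * P"
proof -
  define F where "F a = Abs_fps (\<lambda>n. path_sum A x n {} - path_sum A x n {a})" for a
  have F: "(1 + fps_const (x a) * fps_X) * F a = fps_const (x a) * fps_X * P" if "a \<in> A" for a
  proof (rule fps_ext)
    fix n
    show "fps_nth ((1 + fps_const (x a) * fps_X) * F a) n = fps_nth (fps_const (x a) * fps_X * P) n"
    proof (cases n)
      case 0
      then show ?thesis by (simp add: F_def P_def)
    next
      case (Suc k)
      have "fps_nth ((1 + fps_const (x a) * fps_X) * F a) n =
          (path_sum A x (Suc k) {} - path_sum A x (Suc k) {a}) + x a * (path_sum A x k {} - path_sum A x k {a})"
        by (simp add: F_def Suc distrib_right mult.assoc del: path_sum.simps)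
      also have "\<dots> = x a * path_sum A x k {}"
        by (subst path_sum_diff[OF assms(1) that]) (simp add: algebra_simps)
      finally show ?thesis by (simp add: P_def Suc mult.assoc)
    qed
  qed
  have P: "P = 1 + (\<Sum>a\<in>A. F a)"
  proof (rule fps_ext)
    fix n
    show "fps_nth P n = fps_nth (1 + (\<Sum>a\<in>A. F a)) n"
    proof (cases n)
      case 0
      then show ?thesis by (simp add: P_def F_def fps_sum_nth)
    next
      case (Suc k)
      have "fps_nth (\<Sum>a\<in>A. F a) n = (\<Sum>a\<in>A. x a * path_sum A x k {a})"
        unfolding fps_sum_nth F_def Suc fps_nth_Abs_fps
        by (rule sum.cong) (simp_all only: path_sum_diff[OF assms(1)])
      then show ?thesis by (simp add: P_def Suc)
    qed
  qed
  have "efps A x * (\<Sum>a\<in>A. F a) = (\<Sum>a\<in>A. efps (A - {a}) x * ((1 + fps_const (x a) * fps_X) * F a))"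
    unfolding sum_distrib_left
    by (rule sum.cong) (simp_all add: efps_remove[OF assms(1)] mult_ac)
  also have "\<dots> = (\<Sum>a\<in>A. efps (A - {a}) x * (fps_const (x a) * fps_X * P))"
    by (rule sum.cong) (simp_all add: F)
  also have "\<dots> = fps_X * fps_deriv (efps A x) * P"
    by (simp add: fps_deriv_efps[OF assms(1)] sum_distrib_left sum_distrib_right mult_ac)
  finally show ?thesis
    by (subst P) (simp add: distrib_left)
qed

lemma path_sum_eq_path_e:
  assumes "finite A"
  shows "path_sum A x n {} = path_e (esum A x) n"
proof (induction n rule: less_induct)
  case (less n)
  show ?case
  proof (cases n)
    case 0
    then show ?thesis by simp
  next
    case (Suc k)
    let ?p = "\<lambda>n. path_sum A x n {}"
    have "(\<Sum>i=0..n. esum A x i * ?p (n - i)) = esum A x n + (\<Sum>i=0..k. of_nat (Suc i) * esum A x (Suc i) * ?p (k - i))"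
    proof -
      let ?E = "efps A x" and ?P = "Abs_fps ?p"
      have "fps_nth (fps_X * fps_deriv ?E * ?P) n = fps_nth (fps_deriv ?E * ?P) k"
        by (simp add: Suc mult.assoc)
      moreover have "fps_nth (?E * ?P) n = fps_nth ?E n + fps_nth (fps_X * fps_deriv ?E * ?P) n"
        by (subst path_fps_eq[OF assms]) simp
      ultimately show ?thesis
        by (simp add: fps_mult_nth esum_def mult.assoc)
    qed
    moreover have "(\<Sum>i=0..n. esum A x i * ?p (n - i)) = ?p n + (\<Sum>i=0..k. esum A x (Suc i) * ?p (k - i))"
      unfolding Suc sum.atLeast0_atMost_Suc_shift by (simp add: esum_0[OF assms] del: path_sum.simps)
    \<comment> \<open>Subtracting the terms from E P lowers each weight from i+1 to i, so the term i
      = 0 vanishes and the sum may start at 1 as in \<open>path_e\<close>.\<close>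
    ultimately have "?p n = esum A x n + (\<Sum>i=0..k. of_nat i * (esum A x (Suc i) * ?p (k - i)))"
      by (simp add: algebra_simps sum.distrib del: path_sum.simps)
    also have "(\<Sum>i=0..k. of_nat i * (esum A x (Suc i) * ?p (k - i))) =
        (\<Sum>i=1..k. of_nat i * (esum A x (Suc i) * ?p (k - i)))"
      by (simp add: sum.atLeast_Suc_atMost)
    also have "\<dots> = (\<Sum>i=1..k. of_nat i * (esum A x (Suc i) * path_e (esum A x) (k - i)))"
      by (rule sum.cong) (use less Suc in auto)
    finally show ?thesis by (simp add: Suc)
  qed
qed

section \<open>Power sums and Newton's identities\<close>

definition psum :: "nat set \<Rightarrow> (nat \<Rightarrow> 'a::comm_ring_1) \<Rightarrow> nat \<Rightarrow> 'a" where
  "psum A x k = (\<Sum>a\<in>A. x a ^ k)"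

lemma newton_identity:
  assumes "finite A"
  shows "(\<Sum>i=0..n. esum A x i * ((-1) ^ (n - i) * psum A x (Suc (n - i)))) =
    of_nat (Suc n) * esum A x (Suc n)"
proof -
  \<comment> \<open>\<open>G a\<close> is x_a / (1 + x_a z), so the sum of all \<open>G a\<close> is
    the logarithmic derivative of E, with signed power sums as coefficients.\<close>
  define G where "G a = Abs_fps (\<lambda>n. (-1) ^ n * x a ^ Suc n)" for a
  have G: "(1 + fps_const (x a) * fps_X) * G a = fps_const (x a)" for a
  proof (rule fps_ext)
    fix n
    show "fps_nth ((1 + fps_const (x a) * fps_X) * G a) n = fps_nth (fps_const (x a)) n"
      by (cases n) (simp_all add: G_def distrib_right mult.assoc algebra_simps)
  qed
  have "efps A x * (\<Sum>a\<in>A. G a) = (\<Sum>a\<in>A. efps (A - {a}) x * ((1 + fps_const (x a) * fps_X) * G a))"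
    unfolding sum_distrib_left
    by (rule sum.cong) (simp_all add: efps_remove[OF assms(1)] mult_ac)
  also have "\<dots> = fps_deriv (efps A x)"
    unfolding G fps_deriv_efps[OF assms(1)] by (simp add: mult.commute)
  finally have "fps_nth (efps A x * (\<Sum>a\<in>A. G a)) n = fps_nth (fps_deriv (efps A x)) n" by simp
  moreover have "fps_nth (\<Sum>a\<in>A. G a) k = (-1) ^ k * psum A x (Suc k)" for k
    by (simp add: fps_sum_nth G_def psum_def sum_distrib_left)
  ultimately show ?thesis
    by (simp add: fps_mult_nth esum_def)
qed

lemma newton_psum:
  fixes x :: "nat \<Rightarrow> 'a::comm_ring_1"
  assumes "finite A"
  defines "e \<equiv> esum A x"
  shows "psum A x 1 = e 1"
    and "psum A x 2 = e 1 * psum A x 1 - 2 * e 2"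
    and "psum A x 3 = e 1 * psum A x 2 - e 2 * psum A x 1 + 3 * e 3"
    and "psum A x 4 = e 1 * psum A x 3 - e 2 * psum A x 2 + e 3 * psum A x 1 - 4 * e 4"
    and "psum A x 5 = e 1 * psum A x 4 - e 2 * psum A x 3 + e 3 * psum A x 2 - e 4 * psum A x 1 + 5 * e 5"
  using newton_identity[OF assms(1), of x 0] newton_identity[OF assms(1), of x 1]
    newton_identity[OF assms(1), of x 2] newton_identity[OF assms(1), of x 3]
    newton_identity[OF assms(1), of x 4]
  by (simp_all add: esum_0[OF assms(1), of x, folded e_def] e_def[symmetric] numeral_eq_Suc algebra_simps)

text \<open>Used with \<open>w\<close> constantly 1, giving power sums, and with \<open>w\<close>
  the first-color part of the tail.\<close>

lemma sum_poly5:
  fixes x :: "nat \<Rightarrow> 'a::comm_ring_1"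
  shows "(\<Sum>a\<in>A. w a * (c0 + c1 * x a + c2 * x a ^ 2 + c3 * x a ^ 3 + c4 * x a ^ 4 + c5 * x a ^ 5)) =
    c0 * (\<Sum>a\<in>A. w a) + c1 * (\<Sum>a\<in>A. w a * x a) + c2 * (\<Sum>a\<in>A. w a * x a ^ 2) +
    c3 * (\<Sum>a\<in>A. w a * x a ^ 3) + c4 * (\<Sum>a\<in>A. w a * x a ^ 4) + c5 * (\<Sum>a\<in>A. w a * x a ^ 5)"
  by (simp add: sum_distrib_left sum.distrib[symmetric] algebra_simps)

lemma sum_poly5_psum:
  fixes x :: "nat \<Rightarrow> 'a::comm_ring_1"
  shows "(\<Sum>a\<in>A. c1 * x a + c2 * x a ^ 2 + c3 * x a ^ 3 + c4 * x a ^ 4 + c5 * x a ^ 5) =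
    c1 * psum A x 1 + c2 * psum A x 2 + c3 * psum A x 3 + c4 * psum A x 4 + c5 * psum A x 5"
  using sum_poly5[of "\<lambda>_. 1" 0 c1 x c2 c3 c4 c5 A] by (simp add: psum_def)

text \<open>
  The contribution of \<open>v\<^sub>2\<close> (color \<open>s\<close>) and of \<open>v\<^sub>1, v\<^sub>3\<close>, which are independent of each other,
  when \<open>v\<^sub>4\<close> and its twin have the colors \<open>p\<close> and \<open>q\<close>.
\<close>

definition cycle_sum :: "nat set \<Rightarrow> (nat \<Rightarrow> 'a::comm_ring_1) \<Rightarrow> nat \<Rightarrow> nat \<Rightarrow> 'a" where
  "cycle_sum A x p q = (\<Sum>s\<in>A. x s * (\<Sum>r\<in>A - {p, q, s}. x r)\<^sup>2)"

context
  fixes A :: "nat set" and x :: "nat \<Rightarrow> 'a::comm_ring_1" and S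
  assumes fin: "finite A"
  defines "S \<equiv> psum A x"
begin

lemma sum_eq_S: "(\<Sum>r\<in>A. x r) = S 1"
  by (simp add: S_def psum_def)

text \<open>Here a is the sum of the variables other than those of p and q. For s in {p, q} the
  inner sum is a, otherwise a - x_s; the latter terms are summed over all of A and corrected at p
  and q.\<close>

lemma cycle_sum_eq:
  assumes "p \<in> A" "q \<in> A" "p \<noteq> q"
  defines "a \<equiv> S 1 - x p - x q"
  shows "cycle_sum A x p q = S 1 * a\<^sup>2 - 2 * a * S 2 + S 3 + 2 * a * x p ^ 2 - x p ^ 3
    + 2 * a * x q ^ 2 - x q ^ 3"
proof -
  have split: "sum f A = f p + f q + sum f (A - {p, q})" for f :: "nat \<Rightarrow> 'a"
    using assms fin by (simp add: sum.remove[of A p] sum.remove[of "A - {p}" q] Diff_insert2[symmetric]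
      insert_commute add.assoc)
  have a: "(\<Sum>r\<in>A - {p, q}. x r) = a"
    using split[of x] by (simp add: a_def sum_eq_S)
  have inner: "(\<Sum>r\<in>A - {p, q, s}. x r) = a - x s" if "s \<in> A - {p, q}" for s
  proof -
    have "A - {p, q, s} = A - {p, q} - {s}" by auto
    then show ?thesis using sum.remove[of "A - {p, q}" s x] that fin by (simp add: a)
  qed
  let ?g = "\<lambda>s. x s * (a - x s)\<^sup>2"
  have "cycle_sum A x p q = x p * a\<^sup>2 + x q * a\<^sup>2 + (\<Sum>s\<in>A - {p, q}. ?g s)"
  proof -
    have "A - {p, q, p} = A - {p, q}" by auto
    then show ?thesis
      unfolding cycle_sum_def by (subst split) (simp add: inner a)
  qed
  also have "\<dots> = x p * a\<^sup>2 + x q * a\<^sup>2 + (sum ?g A - ?g p - ?g q)"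
    by (subst split[of ?g]) simp
  also have "sum ?g A = (\<Sum>s\<in>A. a\<^sup>2 * x s + (- 2 * a) * x s ^ 2 + 1 * x s ^ 3 + 0 * x s ^ 4 + 0 * x s ^ 5)"
    by (rule sum.cong) (simp_all add: algebra_simps power2_eq_square power3_eq_cube)
  also have "\<dots> = a\<^sup>2 * S 1 - 2 * a * S 2 + S 3"
    unfolding sum_poly5_psum by (simp add: S_def)
  finally show ?thesis
    by (simp add: algebra_simps power2_eq_square power3_eq_cube)
qed

lemma cycle_sum_commute: "cycle_sum A x p q = cycle_sum A x q p"
  by (simp add: cycle_sum_def insert_commute)

lemma sum_cycle_sum:
  assumes "p \<in> A"
  shows "(\<Sum>q\<in>A - {p}. x q * cycle_sum A x p q) =
    (S 1 ^ 4 - 4 * S 1 ^ 2 * S 2 + 4 * S 1 * S 3 + 2 * S 2 ^ 2 - 3 * S 4)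
    + (- 3 * S 1 ^ 3 + 6 * S 1 * S 2 - 3 * S 3) * x p + (7 * S 1 ^ 2 - 6 * S 2) * x p ^ 2
    - 11 * S 1 * x p ^ 3 + 10 * x p ^ 4"
proof -
  \<comment> \<open>The summand expanded in powers of \<open>x q\<close>; the sum over all q becomes
    power sums, and the term q = p is then removed.\<close>
  let ?f = "\<lambda>q. (S 1 ^ 3 - 2 * S 1 ^ 2 * x p - 2 * S 1 * S 2 + 3 * S 1 * x p ^ 2 + 2 * S 2 * x p
        + S 3 - 3 * x p ^ 3) * x q + (- 2 * S 1 ^ 2 + 2 * S 1 * x p + 2 * S 2 - 2 * x p ^ 2) * x q ^ 2
        + (3 * S 1 - 2 * x p) * x q ^ 3 + (- 3) * x q ^ 4 + 0 * x q ^ 5"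
  have "(\<Sum>q\<in>A - {p}. x q * cycle_sum A x p q) = sum ?f (A - {p})"
    by (rule sum.cong) (use assms in \<open>simp_all add: cycle_sum_eq algebra_simps eval_nat_numeral\<close>)
  also have "\<dots> = sum ?f A - ?f p"
    using assms fin by (simp add: sum_diff1)
  also have "\<dots> = (S 1 ^ 4 - 4 * S 1 ^ 2 * S 2 + 4 * S 1 * S 3 + 2 * S 2 ^ 2 - 3 * S 4)
    + (- 3 * S 1 ^ 3 + 6 * S 1 * S 2 - 3 * S 3) * x p + (7 * S 1 ^ 2 - 6 * S 2) * x p ^ 2
    - 11 * S 1 * x p ^ 3 + 10 * x p ^ 4"
    unfolding sum_poly5_psum S_def[symmetric] by (simp add: algebra_simps eval_nat_numeral)
  finally show ?thesis .
qed

text \<open>The first identity needs a first vertex: for b = 0 its left side is 0. The second is the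
  path recursion read backwards, trading one power of x_a for one more vertex of the path.\<close>

lemma sum_first_color:
  shows "0 < b \<Longrightarrow> (\<Sum>a\<in>A. path_sum A x b {} - path_sum A x b {a}) = path_sum A x b {}"
    and "(\<Sum>a\<in>A. (path_sum A x b {} - path_sum A x b {a}) * x a ^ Suc k) =
      S (Suc k) * path_sum A x b {}
      - (\<Sum>a\<in>A. (path_sum A x (Suc b) {} - path_sum A x (Suc b) {a}) * x a ^ k)"
proof -
  show "(\<Sum>a\<in>A. path_sum A x b {} - path_sum A x b {a}) = path_sum A x b {}" if b: "0 < b"
  proof -
    obtain n where n: "b = Suc n" using b by (cases b) auto
    have "(\<Sum>a\<in>A. path_sum A x b {} - path_sum A x b {a}) = (\<Sum>a\<in>A. x a * path_sum A x n {a})"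
      unfolding n by (rule sum.cong) (simp_all only: path_sum_diff[OF fin])
    then show ?thesis by (simp add: n)
  qed
  have "(\<Sum>a\<in>A. (path_sum A x (Suc b) {} - path_sum A x (Suc b) {a}) * x a ^ k) =
      (\<Sum>a\<in>A. x a * path_sum A x b {a} * x a ^ k)"
    by (rule sum.cong) (simp_all only: path_sum_diff[OF fin])
  then show "(\<Sum>a\<in>A. (path_sum A x b {} - path_sum A x b {a}) * x a ^ Suc k) =
      S (Suc k) * path_sum A x b {}
      - (\<Sum>a\<in>A. (path_sum A x (Suc b) {} - path_sum A x (Suc b) {a}) * x a ^ k)"
    by (simp add: S_def psum_def sum_distrib_left sum_distrib_right sum_subtractf algebra_simps)
qed

lemma twin_tadpole_sum_eq:
  assumes "0 < b"
  shows "(\<Sum>p\<in>A. \<Sum>q\<in>A - {p}. x p * x q * path_sum A x b {p, q} * cycle_sum A x p q) =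
    twin_tadpole_e (esum A x) b"
proof -
  define F where "F b a = path_sum A x b {} - path_sum A x b {a}" for b a
  define P where "P n = path_sum A x n {}" for n
  define L where "L p = (\<Sum>q\<in>A - {p}. x q * cycle_sum A x p q)" for p
  let ?h = "\<lambda>p q. x p * x q * cycle_sum A x p q"
  \<comment> \<open>Makes the inner index set independent of p, so that the two sums can be
    exchanged.\<close>
  have diag: "(\<Sum>q\<in>A - {p}. f q) = (\<Sum>q\<in>A. if q \<noteq> p then f q else 0)" for f :: "nat \<Rightarrow> 'a" and p
  proof -
    have "A - {p} = A \<inter> {q. q \<noteq> p}" by auto
    then show ?thesis using fin by (simp add: sum.If_cases)
  qed
  have pair: "path_sum A x b {p, q} = P b - F b p - F b q" if "p \<in> A" "q \<in> A" "q \<noteq> p" for p q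
    unfolding P_def F_def by (rule path_sum_pair) (use fin that assms in auto)
  \<comment> \<open>The weight \<open>?h\<close> is symmetric in the twins, so both corrections of
    the tail contribute equally and only functions of p remain.\<close>
  have swap: "(\<Sum>p\<in>A. \<Sum>q\<in>A - {p}. ?h p q * F b q) = (\<Sum>p\<in>A. \<Sum>q\<in>A - {p}. ?h p q * F b p)"
    unfolding diag by (subst sum.swap) (intro sum.cong refl, simp add: cycle_sum_commute mult_ac)
  have "(\<Sum>p\<in>A. \<Sum>q\<in>A - {p}. x p * x q * path_sum A x b {p, q} * cycle_sum A x p q) =
      (\<Sum>p\<in>A. \<Sum>q\<in>A - {p}. ?h p q * P b - ?h p q * F b p - ?h p q * F b q)"
    by (intro sum.cong refl) (simp add: pair algebra_simps)
  also have "\<dots> = (\<Sum>p\<in>A. \<Sum>q\<in>A - {p}. ?h p q * P b) - 2 * (\<Sum>p\<in>A. \<Sum>q\<in>A - {p}. ?h p q * F b p)"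
    unfolding sum_subtractf swap by simp
  also have "\<dots> = P b * (\<Sum>p\<in>A. x p * L p) - 2 * (\<Sum>p\<in>A. F b p * (x p * L p))"
    by (simp add: L_def sum_distrib_left mult_ac)
  finally have 1: "(\<Sum>p\<in>A. \<Sum>q\<in>A - {p}. x p * x q * path_sum A x b {p, q} * cycle_sum A x p q) = \<dots>" .
  define c1 where "c1 = S 1 ^ 4 - 4 * S 1 ^ 2 * S 2 + 4 * S 1 * S 3 + 2 * S 2 ^ 2 - 3 * S 4"
  define c2 where "c2 = - 3 * S 1 ^ 3 + 6 * S 1 * S 2 - 3 * S 3"
  define c3 where "c3 = 7 * S 1 ^ 2 - 6 * S 2"
  have xL: "x p * L p = c1 * x p + c2 * x p ^ 2 + c3 * x p ^ 3 + (- 11 * S 1) * x p ^ 4 + 10 * x p ^ 5"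
    if "p \<in> A" for p
    unfolding L_def sum_cycle_sum[OF that] c1_def[symmetric] c2_def[symmetric] c3_def[symmetric]
    by (simp add: algebra_simps eval_nat_numeral)
  have 2: "(\<Sum>p\<in>A. x p * L p) = c1 * S 1 + c2 * S 2 + c3 * S 3 + (- 11 * S 1) * S 4 + 10 * S 5"
    unfolding S_def sum_poly5_psum[symmetric] unfolding S_def[symmetric] by (rule sum.cong) (simp_all add: xL)
  \<comment> \<open>\<open>QS\<close> lowers the exponent k while lengthening the path; after at
    most five steps \<open>Q0\<close> leaves only power sums and path sums.\<close>
  define Q where "Q k n = (\<Sum>a\<in>A. F n a * x a ^ k)" for k n
  have Q0: "Q 0 n = P n" if "0 < n" for n
    using sum_first_color(1)[OF that] by (simp add: Q_def P_def F_def)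
  have QS: "Q (Suc k) n = S (Suc k) * P n - Q k (Suc n)" for k n
    using sum_first_color(2)[of n k] by (simp add: Q_def P_def F_def del: path_sum.simps)
  have "(\<Sum>p\<in>A. F b p * (x p * L p)) =
     (\<Sum>p\<in>A. F b p * (0 + c1 * x p + c2 * x p ^ 2 + c3 * x p ^ 3 + (- 11 * S 1) * x p ^ 4 + 10 * x p ^ 5))"
    by (rule sum.cong) (simp_all add: xL)
  also have "\<dots> = c1 * Q 1 b + c2 * Q 2 b + c3 * Q 3 b + (- 11 * S 1) * Q 4 b + 10 * Q 5 b"
    unfolding sum_poly5 by (simp add: Q_def)
  finally have 3: "(\<Sum>p\<in>A. F b p * (x p * L p)) = \<dots>" .
  have Q: "Q 1 b = S 1 * P b - P (b + 1)"
    "Q 2 b = S 2 * P b - S 1 * P (b + 1) + P (b + 2)"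
    "Q 3 b = S 3 * P b - S 2 * P (b + 1) + S 1 * P (b + 2) - P (b + 3)"
    "Q 4 b = S 4 * P b - S 3 * P (b + 1) + S 2 * P (b + 2) - S 1 * P (b + 3) + P (b + 4)"
    "Q 5 b = S 5 * P b - S 4 * P (b + 1) + S 3 * P (b + 2) - S 2 * P (b + 3) + S 1 * P (b + 4) - P (b + 5)"
    by (simp_all add: eval_nat_numeral QS Q0 del: path_sum.simps)
  define e where "e = esum A x"
  have path: "path_e e n = P n" for n
    by (simp add: P_def e_def path_sum_eq_path_e[OF fin])
  note newton = newton_psum[OF fin, of x, folded S_def e_def]
  have s1: "S 1 = e 1" using newton(1) .
  have s2: "S 2 = e 1 ^ 2 - 2 * e 2"
    unfolding newton(2) s1 by (simp add: power2_eq_square)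
  have s3: "S 3 = e 1 ^ 3 - 3 * (e 1 * e 2) + 3 * e 3"
    unfolding newton(3) s2 s1 by (simp add: algebra_simps eval_nat_numeral)
  have s4: "S 4 = e 1 ^ 4 - 4 * (e 1 ^ 2 * e 2) + 4 * (e 1 * e 3) + 2 * e 2 ^ 2 - 4 * e 4"
    unfolding newton(4) s3 s2 s1 by (simp add: algebra_simps eval_nat_numeral)
  have s5: "S 5 = e 1 ^ 5 - 5 * (e 1 ^ 3 * e 2) + 5 * (e 1 ^ 2 * e 3) + 5 * (e 1 * e 2 ^ 2)
      - 5 * (e 1 * e 4) - 5 * (e 2 * e 3) + 5 * e 5"
    unfolding newton(5) s4 s3 s2 s1 by (simp add: algebra_simps eval_nat_numeral)
  show ?thesis
    unfolding 1 2 3 Q twin_tadpole_e_def path e_def[symmetric] c1_def c2_def c3_def s1 s2 s3 s4 s5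
    by (simp add: algebra_simps eval_nat_numeral)
qed

end

section \<open>Colorings with finitely many colors\<close>

text \<open>The constraint is an arbitrary predicate rather than a graph, so that vertices can be
  removed one by one while the colors already chosen are absorbed into the predicate.\<close>

definition coloring_sum ::
    "nat set \<Rightarrow> (nat \<Rightarrow> 'a::comm_ring_1) \<Rightarrow> 'v set \<Rightarrow> (('v \<Rightarrow> nat) \<Rightarrow> bool) \<Rightarrow> 'a" where
  "coloring_sum A x V R = (\<Sum>\<kappa>\<in>V \<rightarrow>\<^sub>E A. if R \<kappa> then \<Prod>v\<in>V. x (\<kappa> v) else 0)"

lemma coloring_sum_cong:
  "(\<And>\<kappa>. R \<kappa> \<longleftrightarrow> R' \<kappa>) \<Longrightarrow> coloring_sum A x V R = coloring_sum A x V R'"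
  by (simp add: coloring_sum_def)

lemma coloring_sum_conj_const:
  "coloring_sum A x V (\<lambda>\<kappa>. c \<and> R \<kappa>) = (if c then coloring_sum A x V R else 0)"
  by (simp add: coloring_sum_def)

lemma coloring_sum_insert:
  assumes "finite V" "v \<notin> V"
  shows "coloring_sum A x (insert v V) R =
    (\<Sum>a\<in>A. x a * coloring_sum A x V (\<lambda>\<kappa>. R (\<kappa>(v := a))))"
proof -
  have inj: "inj_on (\<lambda>(a, \<kappa>). \<kappa>(v := a)) (A \<times> (V \<rightarrow>\<^sub>E A))"
    using assms(2) by (rule inj_combinator)
  have prod: "(\<Prod>u\<in>V. x ((\<kappa>(v := a)) u)) = (\<Prod>u\<in>V. x (\<kappa> u))" for \<kappa> a
    by (rule prod.cong) (use assms(2) in auto)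
  have eq: "(if R (\<kappa>(v := a)) then \<Prod>u\<in>insert v V. x ((\<kappa>(v := a)) u) else 0) =
      x a * (if R (\<kappa>(v := a)) then \<Prod>u\<in>V. x (\<kappa> u) else 0)" for \<kappa> a
    unfolding prod.insert[OF assms] prod by simp
  show ?thesis
    unfolding coloring_sum_def PiE_insert_eq sum.reindex[OF inj] sum_distrib_left sum.cartesian_product
    by (rule sum.cong) (auto simp only: o_def case_prod_conv eq)
qed

text \<open>Both the starting vertex s and the forbidden set S vary: once vertex s has color a, the
  rest is a path starting at s+1 with forbidden set {a}.\<close>

lemma coloring_sum_path:
  "coloring_sum A x (Some ` {s..<s + n})
     (\<lambda>\<kappa>. (0 < n \<longrightarrow> \<kappa> (Some s) \<notin> S) \<and>
       (\<forall>j. s \<le> j \<and> Suc j < s + n \<longrightarrow> \<kappa> (Some j) \<noteq> \<kappa> (Some (Suc j)))) = path_sum A x n S"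
  if "finite A"
proof (induction n arbitrary: s S)
  case 0
  then show ?case by (simp add: coloring_sum_def)
next
  case (Suc n)
  let ?Q = "\<lambda>s n \<kappa>. \<forall>j. s \<le> j \<and> Suc j < s + n \<longrightarrow> \<kappa> (Some j) \<noteq> \<kappa> (Some (Suc j))"
  let ?V = "Some ` {Suc s..<Suc s + n}"
  have V: "Some ` {s..<s + Suc n} = insert (Some s) ?V"
    by (auto simp: image_iff)
  have upd: "((0 < Suc n \<longrightarrow> (\<kappa>(Some s := a)) (Some s) \<notin> S) \<and> ?Q s (Suc n) (\<kappa>(Some s := a))) \<longleftrightarrow>
      a \<notin> S \<and> ((0 < n \<longrightarrow> \<kappa> (Some (Suc s)) \<notin> {a}) \<and> ?Q (Suc s) n \<kappa>)"
    (is "?l \<longleftrightarrow> ?r") for \<kappa> :: "nat option \<Rightarrow> nat" and a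
  proof
    assume l: ?l
    then have "a \<notin> S" by simp
    moreover have "\<kappa> (Some (Suc s)) \<notin> {a}" if "0 < n"
      using conjunct2[OF l, rule_format, of s] that by auto
    moreover have "?Q (Suc s) n \<kappa>"
      using conjunct2[OF l] by (auto simp: fun_upd_def split: if_splits)
    ultimately show ?r by blast
  next
    assume r: ?r
    have "?Q s (Suc n) (\<kappa>(Some s := a))"
    proof (intro allI impI)
      fix j assume "s \<le> j \<and> Suc j < s + Suc n"
      then show "(\<kappa>(Some s := a)) (Some j) \<noteq> (\<kappa>(Some s := a)) (Some (Suc j))"
        using r by (cases "j = s") auto
    qed
    with r show ?l by simp
  qed
  have "coloring_sum A x (Some ` {s..<s + Suc n})
      (\<lambda>\<kappa>. (0 < Suc n \<longrightarrow> \<kappa> (Some s) \<notin> S) \<and> ?Q s (Suc n) \<kappa>) =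
      (\<Sum>a\<in>A. x a * (if a \<notin> S then path_sum A x n {a} else 0))"
    unfolding V by (subst coloring_sum_insert) (auto simp only: upd coloring_sum_conj_const Suc.IH,
      auto)
  also have "\<dots> = (\<Sum>a\<in>A - S. x a * path_sum A x n {a})"
    by (rule sum.mono_neutral_cong_right) (use that in auto)
  finally show ?case by simp
qed

section \<open>The twinned tadpole made explicit; its vertices are listed in the order in which they
  are to be colored\<close>

lemma verts_twin_tadpole:
  "verts (twin (tadpole 4 b) 4) =
    insert None (insert (Some 4) (insert (Some 2) (insert (Some 1) (insert (Some 3) (Some ` {5..<5 + b})))))"
proof -
  have "{1..4 + b} = insert 4 (insert 2 (insert 1 (insert 3 {5..<5 + b})))"
    by auto
  then show ?thesis by (simp add: twin_def tadpole_def verts_def)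
qed

lemma edges_twin_tadpole:
  "edges (twin (tadpole 4 b) 4) =
    {{Some 1, Some 2}, {Some 2, Some 3}, {Some 3, Some 4}, {Some 4, Some 1}, {Some 4, Some 5},
     {None, Some 4}, {None, Some 1}, {None, Some 3}, {None, Some 5}}
    \<union> {{Some j, Some (Suc j)} | j. 5 \<le> j \<and> Suc j < 5 + b}"
proof -
  have tad: "edges (tadpole 4 b) = {{1, 2}, {2, 3}, {3, 4}, {4, 1}, {4, 5}} \<union>
      {{j, Suc j} | j. 5 \<le> j \<and> Suc j < 5 + b}"
  proof -
    have "{i. 1 \<le> i \<and> i < 4} = {1, 2, 3 :: nat}"
      by auto
    moreover have "1 + 1 = (2 :: nat)" "2 + 1 = (3 :: nat)" "3 + 1 = (4 :: nat)"
      by simp_all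
    ultimately have "{{i, i + 1} | i. 1 \<le> i \<and> i < 4} = {{1, 2}, {2, 3}, {3, 4 :: nat}}"
      by (simp only: setcompr_eq_image image_insert image_empty)
    moreover have "{{i, i + 1} | i. 4 + 1 \<le> i \<and> i < 4 + b} = {{j, Suc j} | j. 5 \<le> j \<and> Suc j < 5 + b}"
      by (rule Collect_cong) auto
    ultimately have "edges (tadpole 4 b) = {{1, 2}, {2, 3}, {3, 4}} \<union> {{4, 1}} \<union>
        {{j, Suc j} | j. 5 \<le> j \<and> Suc j < 5 + b} \<union> {{4, 4 + 1}}"
      by (simp only: tadpole_def edges_def snd_conv)
    then show ?thesis by (simp add: insert_commute)
  qed
  have nbr: "{4, u} \<in> edges (tadpole 4 b) \<longleftrightarrow> u \<in> {1, 3, 5}" for u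
    unfolding tad by (auto simp: doubleton_eq_iff)
  have "edges (twin (tadpole 4 b) 4) = (`) Some ` edges (tadpole 4 b) \<union> {{None, Some 4}}
      \<union> (\<lambda>u. {None, Some u}) ` {1, 3, 5}"
  proof -
    have "{u. {4, u} \<in> edges (tadpole 4 b)} = {1, 3, 5}"
      using nbr by blast
    moreover have "edges (U, B) = B" for U :: "nat option set" and B
      by (simp add: edges_def)
    ultimately show ?thesis
      by (simp only: twin_def setcompr_eq_image)
  qed
  moreover have "(`) Some ` {{j, Suc j} | j. 5 \<le> j \<and> Suc j < 5 + b} =
      {{Some j, Some (Suc j)} | j. 5 \<le> j \<and> Suc j < 5 + b}"
    unfolding setcompr_eq_image image_image by simp
  ultimately show ?thesis unfolding tad image_Un by (simp add: insert_commute)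
qed

definition proper :: "'v graph \<Rightarrow> ('v \<Rightarrow> nat) \<Rightarrow> bool" where
  "proper G \<kappa> \<longleftrightarrow> (\<forall>u v. {u, v} \<in> edges G \<longrightarrow> \<kappa> u \<noteq> \<kappa> v)"

lemma proper_twin_tadpole:
  "proper (twin (tadpole 4 b) 4) \<kappa> \<longleftrightarrow>
    \<kappa> (Some 1) \<noteq> \<kappa> (Some 2) \<and> \<kappa> (Some 2) \<noteq> \<kappa> (Some 3) \<and> \<kappa> (Some 3) \<noteq> \<kappa> (Some 4) \<and>
    \<kappa> (Some 4) \<noteq> \<kappa> (Some 1) \<and> \<kappa> (Some 4) \<noteq> \<kappa> (Some 5) \<and> \<kappa> None \<noteq> \<kappa> (Some 4) \<and>
    \<kappa> None \<noteq> \<kappa> (Some 1) \<and> \<kappa> None \<noteq> \<kappa> (Some 3) \<and> \<kappa> None \<noteq> \<kappa> (Some 5) \<and>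
    (\<forall>j. 5 \<le> j \<and> Suc j < 5 + b \<longrightarrow> \<kappa> (Some j) \<noteq> \<kappa> (Some (Suc j)))"
proof -
  have proper: "proper G \<kappa> \<longleftrightarrow> (\<forall>e\<in>edges G. \<forall>u v. e = {u, v} \<longrightarrow> \<kappa> u \<noteq> \<kappa> v)" for G
    by (auto simp: proper_def)
  have edge: "(\<forall>u v. {a, c} = {u, v} \<longrightarrow> \<kappa> u \<noteq> \<kappa> v) \<longleftrightarrow> \<kappa> a \<noteq> \<kappa> c" for a c
    by (auto simp: doubleton_eq_iff)
  have family: "(\<forall>e\<in>{f j | j. Q j}. R e) \<longleftrightarrow> (\<forall>j. Q j \<longrightarrow> R (f j))"
    for f :: "nat \<Rightarrow> nat option set" and Q R
    by blast
  show ?thesis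
    unfolding proper edges_twin_tadpole ball_Un family edge ball_simps(5,7)
    by (simp only: simp_thms conj_assoc)
qed

lemma coloring_sum_twin_tadpole:
  assumes "finite A" "0 < b"
  shows "coloring_sum A x (verts (twin (tadpole 4 b) 4)) (proper (twin (tadpole 4 b) 4)) =
    twin_tadpole_e (esum A x) b"
proof -
  let ?T = "Some ` {5..<5 + b}"
  \<comment> \<open>With v_1, ..., v_4 and the twin colored, the tail only sees that v_5 must avoid
    p and q; v_5 exists because b is positive.\<close>
  have tail: "coloring_sum A x ?T (\<lambda>\<kappa>. proper (twin (tadpole 4 b) 4)
        (\<kappa>(Some 3 := t, Some 1 := r, Some 2 := s, Some 4 := p, None := q))) =
      (if q \<noteq> p \<and> r \<notin> {q, p, s} \<and> t \<notin> {q, p, s} then path_sum A x b {q, p} else 0)"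
    for p q r s t
    unfolding coloring_sum_path[OF assms(1), where s = 5, symmetric] coloring_sum_conj_const[symmetric]
    by (rule coloring_sum_cong) (use assms(2) in \<open>auto simp: proper_twin_tadpole\<close>)
  \<comment> \<open>v_1 (color r) and v_3 (color t) are not adjacent and have the same neighbors,
    which produces the square in \<open>cycle_sum\<close>.\<close>
  have inner: "(\<Sum>s\<in>A. x s * (\<Sum>r\<in>A. x r * (\<Sum>t\<in>A. x t *
        (if q \<noteq> p \<and> r \<notin> {q, p, s} \<and> t \<notin> {q, p, s} then w else 0)))) =
      (if q \<noteq> p then w * cycle_sum A x q p else 0)" for p q and w :: 'a
  proof (cases "q = p")
    case False
    have restrict: "(\<Sum>r\<in>A. x r * (if r \<notin> {q, p, s} then c else 0)) = (\<Sum>r\<in>A - {q, p, s}. x r * c)"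
      for c s
      by (rule sum.mono_neutral_cong_right) (use assms(1) in auto)
    have square: "(\<Sum>r\<in>A. x r * (\<Sum>t\<in>A. x t *
        (if q \<noteq> p \<and> r \<notin> {q, p, s} \<and> t \<notin> {q, p, s} then w else 0))) =
        w * (\<Sum>r\<in>A - {q, p, s}. x r)\<^sup>2" (is "?lhs = _") for s
    proof -
      have "?lhs = (\<Sum>r\<in>A. x r * (if r \<notin> {q, p, s} then
          (\<Sum>t\<in>A. x t * (if t \<notin> {q, p, s} then w else 0)) else 0))"
        by (rule sum.cong) (use False in auto)
      also have "\<dots> = w * (\<Sum>r\<in>A - {q, p, s}. x r)\<^sup>2"
        unfolding restrict sum_distrib_right[symmetric] by (simp add: power2_eq_square mult_ac)
      finally show ?thesis .
    qed
    show ?thesis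
      unfolding square using False by (simp add: cycle_sum_def sum_distrib_left mult_ac)
  qed simp
  have "coloring_sum A x (verts (twin (tadpole 4 b) 4)) (proper (twin (tadpole 4 b) 4)) =
     (\<Sum>q\<in>A. x q * (\<Sum>p\<in>A. x p * (if q \<noteq> p then path_sum A x b {q, p} * cycle_sum A x q p else 0)))"
    unfolding verts_twin_tadpole
    by (simp add: coloring_sum_insert image_iff del: fun_upd_apply One_nat_def)
      (simp only: tail inner)
  also have "\<dots> = (\<Sum>q\<in>A. \<Sum>p\<in>A - {q}. x q * x p * path_sum A x b {q, p} * cycle_sum A x q p)"
    unfolding sum_distrib_left
    by (intro sum.cong refl sum.mono_neutral_cong_right) (use assms(1) in \<open>auto simp: mult_ac\<close>)
  also have "\<dots> = twin_tadpole_e (esum A x) b"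
    by (rule twin_tadpole_sum_eq[OF assms])
  finally show ?thesis .
qed

section \<open>Truncation to finitely many variables\<close>

definition mvar :: "nat \<Rightarrow> int mfps" where
  "mvar i = Abs_mfps (\<lambda>m. if m = {#i#} then 1 else 0)"

text \<open>The substitution of 0 for all indeterminates with index at least N.\<close>

definition truncate :: "nat \<Rightarrow> int mfps \<Rightarrow> int mfps" where
  "truncate N f = Abs_mfps (\<lambda>m. if set_mset m \<subseteq> {..<N} then mcoeff f m else 0)"

lemma mcoeff_truncate: "mcoeff (truncate N f) m = (if set_mset m \<subseteq> {..<N} then mcoeff f m else 0)"
  by (simp add: truncate_def)

interpretation truncate: ring_1_hom "truncate N"
proof
  show "truncate N 1 = 1"
    by (rule mfps_eqI) (auto simp: truncate_def one_mfps_def)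
  show "truncate N (f + g) = truncate N f + truncate N g" for f g
    by (rule mfps_eqI) (simp add: mcoeff_truncate)
  show "truncate N (f * g) = truncate N f * truncate N g" for f g
  proof (rule mfps_eqI)
    fix m :: "nat multiset"
    show "mcoeff (truncate N (f * g)) m = mcoeff (truncate N f * truncate N g) m"
    proof (cases "set_mset m \<subseteq> {..<N}")
      case True
      have "set_mset a \<subseteq> {..<N} \<and> set_mset (m - a) \<subseteq> {..<N}" if "a \<subseteq># m" for a
        using True set_mset_mono[OF that] by (meson in_diffD order_trans subsetI subsetD)
      then show ?thesis
        using True by (simp add: times_mfps_def mcoeff_truncate)
    next
      case False
      have "\<not> set_mset a \<subseteq> {..<N} \<or> \<not> set_mset (m - a) \<subseteq> {..<N}" if "a \<subseteq># m" for a
        using False that by (metis Un_subset_iff set_mset_union subset_mset.add_diff_inverse)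
      then have "(\<Sum>a | a \<subseteq># m. mcoeff (truncate N f) a * mcoeff (truncate N g) (m - a)) = 0"
        by (intro sum.neutral) (auto simp: mcoeff_truncate)
      then show ?thesis
        using False by (simp add: times_mfps_def mcoeff_truncate)
    qed
  qed
qed

lemma truncate_eqI:
  assumes "\<And>N. truncate N f = truncate N g"
  shows "f = g"
proof (rule mfps_eqI)
  fix m :: "nat multiset"
  obtain N where "\<forall>i\<in>set_mset m. i < N"
    using finite_nat_set_iff_bounded finite_set_mset by blast
  then have "set_mset m \<subseteq> {..<N}" by auto
  then show "mcoeff f m = mcoeff g m"
    using arg_cong[OF assms, of "\<lambda>f. mcoeff f m" N] by (simp add: mcoeff_truncate)
qed

lemma mcoeff_mvar_mult:
  "mcoeff (mvar i * f) m = (if i \<in># m then mcoeff f (m - {#i#}) else 0)"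
proof -
  have "mcoeff (mvar i * f) m = (\<Sum>a | a \<subseteq># m. if a = {#i#} then mcoeff f (m - {#i#}) else 0)"
    unfolding times_mfps_def mcoeff_Abs_mfps by (rule sum.cong) (auto simp: mvar_def)
  then show ?thesis by simp
qed

lemma mcoeff_prod_mvar:
  "finite V \<Longrightarrow> mcoeff (\<Prod>v\<in>V. mvar (\<kappa> v)) m = (if image_mset \<kappa> (mset_set V) = m then 1 else 0)"
proof (induction V arbitrary: m rule: finite_induct)
  case empty
  then show ?case by (auto simp: one_mfps_def)
next
  case (insert v V)
  then show ?case
    by (auto simp: mcoeff_mvar_mult dest!: multi_member_split)
qed

text \<open>Induction with e_k(x_0, ..., x_N) = e_k + x_N e_{k-1}, the right side in the first N
  variables; the cases are the multiplicities 0, at least 2, and 1 of N in the monomial.\<close>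

lemma truncate_elem_sym: "truncate N (elem_sym k) = esum {..<N} mvar k"
proof (induction N arbitrary: k)
  case 0
  show ?case
    by (rule mfps_eqI) (auto simp: mcoeff_truncate elem_sym_def esum_def efps_def one_mfps_def)
next
  case (Suc N)
  have step: "esum {..<Suc N} mvar k = esum {..<N} mvar k + (if k = 0 then 0 else mvar N * esum {..<N} mvar (k - 1))"
    by (simp add: esum_def efps_def lessThan_Suc distrib_right mult.assoc)
  show ?case
  proof (rule mfps_eqI)
    fix m
    show "mcoeff (truncate (Suc N) (elem_sym k)) m = mcoeff (esum {..<Suc N} mvar k) m"
    proof (cases "N \<in># m")
      case False
      then have "set_mset m \<subseteq> {..<Suc N} \<longleftrightarrow> set_mset m \<subseteq> {..<N}"
        by (auto simp: lessThan_Suc)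
      with False show ?thesis
        unfolding step Suc.IH[symmetric] by (simp add: mcoeff_truncate mcoeff_mvar_mult)
    next
      case True
      then obtain m' where m: "m = add_mset N m'" by (meson multi_member_split)
      show ?thesis
      proof (cases "N \<in># m'")
        case True
        then have "1 < count m N" by (simp add: m)
        then have "\<not> (\<forall>i. count m i \<le> 1)" by (meson not_less)
        then have "mcoeff (elem_sym k) m = 0"
          by (simp add: elem_sym_def)
        moreover have "\<not> set_mset m' \<subseteq> {..<N}" "\<not> set_mset m \<subseteq> {..<N}"
          using True by (auto simp: m)
        ultimately show ?thesis
          unfolding step Suc.IH[symmetric] by (simp add: mcoeff_truncate mcoeff_mvar_mult m)
      next
        case False
        then have "count m' N = 0" by (simp add: not_in_iff)
        then have "count m i \<le> 1 \<longleftrightarrow> count m' i \<le> 1" for i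
          by (cases "i = N") (simp_all add: m)
        then have "(\<forall>i. count m i \<le> 1) \<longleftrightarrow> (\<forall>i. count m' i \<le> 1)"
          by simp
        moreover have "set_mset m \<subseteq> {..<Suc N} \<longleftrightarrow> set_mset m' \<subseteq> {..<N}"
          using False by (auto simp: m lessThan_Suc)
        moreover have "size m = k \<longleftrightarrow> k \<noteq> 0 \<and> size m' = k - 1"
          by (cases k) (auto simp: m)
        ultimately have "mcoeff (truncate (Suc N) (elem_sym k)) m =
            (if k = 0 then 0 else mcoeff (truncate N (elem_sym (k - 1))) m')"
          using m by (simp add: mcoeff_truncate elem_sym_def)
        moreover have "mcoeff (truncate N (elem_sym k)) m = 0"
          by (simp add: mcoeff_truncate m)
        moreover have "mcoeff (mvar N * f) m = mcoeff f m'" for f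
          by (simp add: mcoeff_mvar_mult m)
        ultimately show ?thesis
          unfolding step Suc.IH[symmetric] by simp
      qed
    qed
  qed
qed

lemma truncate_chromatic_sym:
  assumes "finite (verts G)"
  shows "truncate N (chromatic_sym G) = coloring_sum {..<N} mvar (verts G) (proper G)"
proof (rule mfps_eqI)
  fix m :: "nat multiset"
  let ?V = "verts G"
  let ?mon = "\<lambda>\<kappa>. image_mset \<kappa> (mset_set ?V)"
  have fin: "finite (?V \<rightarrow>\<^sub>E {..<N})"
    using assms by (simp add: finite_PiE)
  have "mcoeff (coloring_sum {..<N} mvar ?V (proper G)) m =
      (\<Sum>\<kappa>\<in>?V \<rightarrow>\<^sub>E {..<N}. if proper G \<kappa> \<and> ?mon \<kappa> = m then 1 else 0)"
    unfolding coloring_sum_def mcoeff_sum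
    by (rule sum.cong) (simp_all add: mcoeff_prod_mvar[OF assms])
  also have "\<dots> = int (card {\<kappa> \<in> ?V \<rightarrow>\<^sub>E {..<N}. proper G \<kappa> \<and> ?mon \<kappa> = m})"
    using fin by (simp add: sum.If_cases Int_def)
  also have "\<dots> = mcoeff (truncate N (chromatic_sym G)) m"
  proof (cases "set_mset m \<subseteq> {..<N}")
    case True
    \<comment> \<open>The monomial of a coloring records every color used, so its support already
      bounds the colors.\<close>
    have "{\<kappa> \<in> ?V \<rightarrow>\<^sub>E {..<N}. proper G \<kappa> \<and> ?mon \<kappa> = m} =
        {\<kappa> \<in> proper_colorings G. ?mon \<kappa> = m}"
      using True assms by (auto simp: proper_colorings_def proper_def PiE_iff image_subset_iff)
    then show ?thesis
      using True by (simp add: mcoeff_truncate chromatic_sym_def)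
  next
    case False
    have "{\<kappa> \<in> ?V \<rightarrow>\<^sub>E {..<N}. proper G \<kappa> \<and> ?mon \<kappa> = m} = {}"
      using False assms by (auto simp: PiE_iff)
    then show ?thesis
      using False by (simp only: mcoeff_truncate if_False card.empty of_nat_0)
  qed
  finally show "mcoeff (truncate N (chromatic_sym G)) m =
      mcoeff (coloring_sum {..<N} mvar ?V (proper G)) m" by simp
qed

lemma chromatic_sym_twin_tadpole:
  assumes "0 < b"
  shows "chromatic_sym (twin (tadpole 4 b) 4) = twin_tadpole_e elem_sym b"
proof (rule truncate_eqI)
  fix N
  have "finite (verts (twin (tadpole 4 b) 4))"
    by (simp add: verts_twin_tadpole)
  then show "truncate N (chromatic_sym (twin (tadpole 4 b) 4)) = truncate N (twin_tadpole_e elem_sym b)"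
    using assms
    by (simp add: truncate_chromatic_sym coloring_sum_twin_tadpole truncate.hom_twin_tadpole_e
        truncate_elem_sym)
qed

section \<open>Extraction of coefficients\<close>

lemma partition_keys_path_e: "partition_keys (path_e epoly_var n)"
proof (induction n rule: less_induct)
  case (less n)
  then show ?case
    by (cases n) (auto intro!: partition_keys_one partition_keys_add partition_keys_sum
        partition_keys_mult partition_keys_of_nat partition_keys_var)
qed

lemma partition_keys_twin_tadpole_e: "partition_keys (twin_tadpole_e epoly_var b)"
  unfolding twin_tadpole_e_def
  by (intro partition_keys_add partition_keys_diff partition_keys_mult partition_keys_numeral
      partition_keys_path_e partition_keys_var) simp_all

lemma e_coeff_twin_tadpole:
  assumes "0 < b"
  shows "e_coeff lam (chromatic_sym (twin (tadpole 4 b) 4)) =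
    Poly_Mapping.lookup (twin_tadpole_e epoly_var b) lam"
proof -
  have "chromatic_sym (twin (tadpole 4 b) 4) = epoly_eval (twin_tadpole_e epoly_var b)"
    using assms by (simp add: chromatic_sym_twin_tadpole epoly_eval.hom_twin_tadpole_e epoly_eval_var)
  then show ?thesis
    by (simp add: e_coeff_epoly_eval partition_keys_twin_tadpole_e)
qed

lemma lookup_var_mult:
  "Poly_Mapping.lookup (epoly_var i * p) lam =
    (if i \<in># lam then Poly_Mapping.lookup p (lam - {#i#}) else 0)"
proof (induction p rule: epoly_induct)
  case (one mu)
  then show ?case
    by (auto simp: epoly_var_def mult_single lookup_single when_def dest!: multi_member_split)
qed (simp_all add: right_diff_distrib lookup_minus)

lemma lookup_of_nat_mult:
  "Poly_Mapping.lookup (of_nat n * p) lam = int n * Poly_Mapping.lookup (p :: epoly) lam"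
  by (induction n) (simp_all add: distrib_right lookup_add)

lemma lookup_numeral_mult:
  "Poly_Mapping.lookup (numeral n * p) lam = numeral n * Poly_Mapping.lookup (p :: epoly) lam"
  using lookup_of_nat_mult[of "numeral n"] by simp

lemma lookup_sum: "Poly_Mapping.lookup (sum f I) lam = (\<Sum>i\<in>I. Poly_Mapping.lookup (f i) lam)"
  by (induction I rule: infinite_finite_induct) (simp_all add: lookup_add)

section \<open>Path coefficients at partitions into threes and at most one further part\<close>

abbreviation path_coeff :: "nat \<Rightarrow> nat multiset \<Rightarrow> int" where
  "path_coeff n lam \<equiv> Poly_Mapping.lookup (path_e epoly_var n) lam"

lemma path_coeff_Suc:
  "path_coeff (Suc n) lam = (if lam = {#Suc n#} then 1 else 0) +
    (\<Sum>i=1..n. if Suc i \<in># lam then int i * path_coeff (n - i) (lam - {#Suc i#}) else 0)"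
  unfolding path_e.simps lookup_add lookup_sum lookup_of_nat_mult lookup_var_mult
  by (auto simp: epoly_var_def lookup_single when_def intro!: sum.cong)

text \<open>The recursion removes a part i with weight i-1. Parts 1 have weight 0, and n at least 2
  keeps both remaining indices in range.\<close>

lemma path_coeff_Suc_123:
  assumes "2 \<le> n" "set_mset lam \<subseteq> {1, 2, 3}"
  shows "path_coeff (Suc n) lam = (if lam = {#Suc n#} then 1 else 0)
    + (if 2 \<in># lam then path_coeff (n - 1) (lam - {#2#}) else 0)
    + (if 3 \<in># lam then 2 * path_coeff (n - 2) (lam - {#3#}) else 0)"
proof -
  have "(\<Sum>i=1..n. if Suc i \<in># lam then int i * path_coeff (n - i) (lam - {#Suc i#}) else 0) =
      (\<Sum>i\<in>{1, 2}. if Suc i \<in># lam then int i * path_coeff (n - i) (lam - {#Suc i#}) else 0)"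
    by (rule sum.mono_neutral_right) (use assms in auto)
  then show ?thesis
    unfolding path_coeff_Suc by (simp add: eval_nat_numeral)
qed

text \<open>P_3 contributes 1 + 2 = 3, and every further part 3 doubles the value.\<close>

lemma path_coeff_3: "path_coeff (3 * Suc m) (replicate_mset (Suc m) 3) = 3 * 2 ^ m"
proof (induction m)
  case 0
  show ?case using path_coeff_Suc_123[of 2 "{#3#}"] by simp
next
  case (Suc m)
  then show ?case
    using path_coeff_Suc_123[of "3 * m + 5" "replicate_mset (Suc (Suc m)) 3"]
    by (simp del: path_e.simps)
qed

lemma path_coeff_31: "path_coeff (3 * m + 1) (add_mset 1 (replicate_mset m 3)) = 2 ^ m"
proof (induction m)
  case 0
  show ?case using path_coeff_Suc[of 0 "{#1#}"] by simp
next
  case (Suc m)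
  then show ?case
    using path_coeff_Suc_123[of "3 * m + 3" "add_mset 1 (replicate_mset (Suc m) 3)"]
    by (simp del: path_e.simps)
qed

text \<open>Removing a 3 doubles the coefficient for m, and removing the 2 adds
  \<open>path_coeff_3\<close>. The factor 2 on the left avoids the exponent m-1.\<close>

lemma path_coeff_32:
  "2 * path_coeff (3 * m + 2) (add_mset 2 (replicate_mset m 3)) = (3 * int m + 4) * 2 ^ m"
proof (induction m)
  case 0
  show ?case using path_coeff_Suc[of 1 "{#2#}"] by (simp add: eval_nat_numeral)
next
  case (Suc m)
  then show ?case
    using path_coeff_Suc_123[of "3 * m + 4" "add_mset 2 (replicate_mset (Suc m) 3)"]
      path_coeff_3[of m]
    by (simp add: algebra_simps del: path_e.simps)
qed

text \<open>A term of \<open>twin_tadpole_e\<close> survives only if all its variables are among the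
  parts. One 3 is written separately so that removing it is immediate.\<close>

lemma lookup_twin_tadpole_e:
  assumes "set_mset lam \<subseteq> {3}"
  shows "Poly_Mapping.lookup (twin_tadpole_e epoly_var b) (add_mset 3 lam) =
      20 * path_coeff (b + 5) (add_mset 3 lam) - 42 * path_coeff (b + 2) lam"
    and "Poly_Mapping.lookup (twin_tadpole_e epoly_var b) (add_mset 1 (add_mset 3 lam)) =
      20 * path_coeff (b + 5) (add_mset 1 (add_mset 3 lam)) + 2 * path_coeff (b + 4) (add_mset 3 lam)
      - 42 * path_coeff (b + 2) (add_mset 1 lam) - 4 * path_coeff (b + 1) lam"
    and "Poly_Mapping.lookup (twin_tadpole_e epoly_var b) (add_mset 2 (add_mset 3 lam)) =
      20 * path_coeff (b + 5) (add_mset 2 (add_mset 3 lam)) - 16 * path_coeff (b + 3) (add_mset 3 lam)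
      - 42 * path_coeff (b + 2) (add_mset 2 lam) - 4 * path_coeff b lam"
proof -
  have "1 \<notin># lam" "2 \<notin># lam" "4 \<notin># lam" "5 \<notin># lam"
    using assms by auto
  then show
    "Poly_Mapping.lookup (twin_tadpole_e epoly_var b) (add_mset 3 lam) =
      20 * path_coeff (b + 5) (add_mset 3 lam) - 42 * path_coeff (b + 2) lam"
    "Poly_Mapping.lookup (twin_tadpole_e epoly_var b) (add_mset 1 (add_mset 3 lam)) =
      20 * path_coeff (b + 5) (add_mset 1 (add_mset 3 lam)) + 2 * path_coeff (b + 4) (add_mset 3 lam)
      - 42 * path_coeff (b + 2) (add_mset 1 lam) - 4 * path_coeff (b + 1) lam"
    "Poly_Mapping.lookup (twin_tadpole_e epoly_var b) (add_mset 2 (add_mset 3 lam)) =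
      20 * path_coeff (b + 5) (add_mset 2 (add_mset 3 lam)) - 16 * path_coeff (b + 3) (add_mset 3 lam)
      - 42 * path_coeff (b + 2) (add_mset 2 lam) - 4 * path_coeff b lam"
    unfolding twin_tadpole_e_def lookup_add lookup_minus lookup_numeral_mult lookup_var_mult
    by (simp_all del: path_e.simps)
qed

lemma twin_tadpole_coeff_3:
  "e_coeff (replicate_mset (k + 2) 3) (chromatic_sym (twin (tadpole 4 (3 * k + 1)) 4)) =
    - 3 * 2 ^ (k + 1)"
proof -
  have lam: "replicate_mset (k + 2) 3 = add_mset 3 (replicate_mset (Suc k) 3)"
    by simp
  have idx: "3 * k + 1 + 5 = 3 * Suc (Suc k)" "3 * k + 1 + 2 = 3 * Suc k"
    by simp_all
  show ?thesis
    unfolding lam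
    apply (subst e_coeff_twin_tadpole, simp)
    apply (subst lookup_twin_tadpole_e(1), simp)
    \<comment> \<open>What remains is 20 * 3 * 2^(k+1) - 42 * 3 * 2^k = -6 * 2^k.\<close>
    unfolding idx replicate_mset_Suc[symmetric] path_coeff_3
    by simp
qed

lemma twin_tadpole_coeff_31:
  "e_coeff (replicate_mset (k + 2) 3 + {#1#}) (chromatic_sym (twin (tadpole 4 (3 * k + 2)) 4)) =
    - (2 ^ (k + 2))"
proof -
  have lam: "replicate_mset (k + 2) 3 + {#1#} = add_mset 1 (add_mset 3 (replicate_mset (Suc k) 3))"
    by simp
  have idx: "3 * k + 2 + 5 = 3 * Suc (Suc k) + 1" "3 * k + 2 + 4 = 3 * Suc (Suc k)"
    "3 * k + 2 + 2 = 3 * Suc k + 1" "3 * k + 2 + 1 = 3 * Suc k"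
    by simp_all
  show ?thesis
    unfolding lam
    apply (subst e_coeff_twin_tadpole, simp)
    apply (subst lookup_twin_tadpole_e(2), simp)
    unfolding idx replicate_mset_Suc[symmetric] path_coeff_3 path_coeff_31
    by simp
qed

lemma twin_tadpole_coeff_32:
  "e_coeff (replicate_mset (k + 2) 3 + {#2#}) (chromatic_sym (twin (tadpole 4 (3 * k + 3)) 4)) =
    - (3 * int k + 1) * 2 ^ (k + 1)"
proof -
  have lam: "replicate_mset (k + 2) 3 + {#2#} = add_mset 2 (add_mset 3 (replicate_mset (Suc k) 3))"
    by simp
  have idx: "3 * k + 3 + 5 = 3 * Suc (Suc k) + 2" "3 * k + 3 + 3 = 3 * Suc (Suc k)"
    "3 * k + 3 + 2 = 3 * Suc k + 2" "3 * k + 3 = 3 * Suc k"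
    by simp_all
  have "e_coeff (replicate_mset (k + 2) 3 + {#2#}) (chromatic_sym (twin (tadpole 4 (3 * k + 3)) 4)) =
      10 * (2 * path_coeff (3 * Suc (Suc k) + 2) (add_mset 2 (replicate_mset (Suc (Suc k)) 3)))
      - 16 * path_coeff (3 * Suc (Suc k)) (replicate_mset (Suc (Suc k)) 3)
      - 21 * (2 * path_coeff (3 * Suc k + 2) (add_mset 2 (replicate_mset (Suc k) 3)))
      - 4 * path_coeff (3 * Suc k) (replicate_mset (Suc k) 3)"
    unfolding lam
    apply (subst e_coeff_twin_tadpole, simp)
    apply (subst lookup_twin_tadpole_e(3), simp)
    \<comment> \<open>The left side of the fourth equation occurs inside those of the others, so it
      is rewritten last.\<close>
    unfolding idx(1-3) replicate_mset_Suc[symmetric] unfolding idx(4)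
    by (simp del: path_e.simps replicate_mset_Suc mult_Suc_right)
  also have "\<dots> = - (3 * int k + 1) * 2 ^ (k + 1)"
    unfolding path_coeff_3 path_coeff_32 by (simp add: algebra_simps)
  finally show ?thesis .
qed

lemma twin_tadpole_not_e_positive:
  assumes "1 \<le> b"
  shows "\<not> e_positive (chromatic_sym (twin (tadpole 4 b) 4))"
proof -
  \<comment> \<open>The three families cover the residues of b modulo 3, so each b has a negative
    coefficient.\<close>
  define k where "k = (b - 1) div 3"
  have "b = 3 * k + 1 \<or> b = 3 * k + 2 \<or> b = 3 * k + 3"
    using assms unfolding k_def by presburger
  then obtain lam where "is_partition lam" "e_coeff lam (chromatic_sym (twin (tadpole 4 b) 4)) < 0"
  proof (elim disjE)
    assume b: "b = 3 * k + 1"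
    show ?thesis
      by (rule that[of "replicate_mset (k + 2) 3"], simp add: is_partition_def, unfold b twin_tadpole_coeff_3) simp
  next
    assume b: "b = 3 * k + 2"
    show ?thesis
      by (rule that[of "replicate_mset (k + 2) 3 + {#1#}"], simp add: is_partition_def,
          unfold b twin_tadpole_coeff_31) simp
  next
    assume b: "b = 3 * k + 3"
    show ?thesis
      by (rule that[of "replicate_mset (k + 2) 3 + {#2#}"], simp add: is_partition_def,
          unfold b twin_tadpole_coeff_32) (simp add: mult_less_0_iff)
  qed
  then show ?thesis
    by (auto simp: e_positive_def not_le)
qed

theorem theorem3p6:
  shows "(\<forall>b::nat. b \<ge> 1 \<longrightarrow> \<not> e_positive (chromatic_sym (twin (tadpole 4 b) 4))) \<and>
    (\<forall>k::nat.
      e_coeff (replicate_mset (k + 2) 3)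
        (chromatic_sym (twin (tadpole 4 (3 * k + 1)) 4)) = - 3 * 2 ^ (k + 1) \<and>
      e_coeff (replicate_mset (k + 2) 3 + {#1#})
        (chromatic_sym (twin (tadpole 4 (3 * k + 2)) 4)) = - (2 ^ (k + 2)) \<and>
      e_coeff (replicate_mset (k + 2) 3 + {#2#})
        (chromatic_sym (twin (tadpole 4 (3 * k + 3)) 4)) = - (3 * int k + 1) * 2 ^ (k + 1))"
proof -
  have "e_coeff (replicate_mset (k + 2) 3)
        (chromatic_sym (twin (tadpole 4 (3 * k + 1)) 4)) = - 3 * 2 ^ (k + 1) \<and>
      e_coeff (replicate_mset (k + 2) 3 + {#1#})
        (chromatic_sym (twin (tadpole 4 (3 * k + 2)) 4)) = - (2 ^ (k + 2)) \<and>
      e_coeff (replicate_mset (k + 2) 3 + {#2#})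
        (chromatic_sym (twin (tadpole 4 (3 * k + 3)) 4)) = - (3 * int k + 1) * 2 ^ (k + 1)" for k
    by (intro conjI twin_tadpole_coeff_3 twin_tadpole_coeff_31 twin_tadpole_coeff_32)
  then show ?thesis
    using twin_tadpole_not_e_positive by blast
qed

end
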